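(* Let $d\ge2$, $a_1>a_2\ge a_3\ge\ldots\ge a_d>0$, and $E:=\{z\in\mathbb R^d:\sum_{j=1}^d(z_j/a_j)^2\le1\}$. Let $Z_1,Z_2,\ldots$ be i.i.d. with the uniform distribution on $E$, for each $n\in\mathbb N$ let $N_n$ be a Poisson random variable with mean $n$ independent of $(Z_i)_{i\ge 1}$, and put $M_n:=\max_{1\le i,j\le n}|Z_i-Z_j|$, $\mathrm{diam}(\mathbf Z_n):=\max_{1\le i,j\le N_n}|Z_i-Z_j|$. Put $$p:=\frac1{m_d(E)}=\left(\frac{\pi^{d/2}}{\Gamma(\frac d2+1)}\prod_{i=1}^da_i\right)^{-1},\qquad P:=\Big\{z\in\mathbb R^d:\sum_{j=2}^d\Big(\frac{z_j}{a_j}\Big)^2\le\frac{2z_1}{a_1}\Big\}.$$ Then, as $n\to\infty$, $$n^{\frac2{d+1}}\big(2a_1-\mathrm{diam}(\mathbf Z_n)\big)\overset{\mathcal D}{\longrightarrow}\min_{i,j\ge1}\Big\{\mathcal X_{i,1}+\mathcal Y_{j,1}-\frac1{4a_1}\big|\widetilde{\mathcal X}_i-\widetilde{\mathcal Y}_j\big|^2\Big\},$$ where $\{\mathcal X_i,i\ge1\}$ and $\{\mathcal Y_j,j\ge1\}$ are independent Poisson processes on $\mathbb R^d$, each with intensity measure $p\cdot m_d|_P$, and the same holds with $\mathrm{diam}(\mathbf Z_n)$ replaced with $M_n$. In particular, for $d=2$ and $a_1=1$ one has $p=1/(\pi a_2)$, $P=\{z\in\mathbb R^2:(z_2/a_2)^2\le2z_1\}$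 and $$n^{2/3}(2-M_n)\overset{\mathcal D}{\longrightarrow}\min_{i,j\ge1}\Big\{\mathcal X_{i,1}+\mathcal Y_{j,1}-\frac14(\mathcal X_{i,2}-\mathcal Y_{j,2})^2\Big\}.$$
   Context: Notation: $|\cdot|$ is the Euclidean norm, $m_d$ Lebesgue measure on $\mathbb R^d$, $\mu|_A(B):=\mu(A\cap B)$, $\widetilde z:=(z_2,\ldots,z_d)$ for $z\in\mathbb R^d$; $\mathcal X_i=(\mathcal X_{i,1},\ldots,\mathcal X_{i,d})$ and similarly for $\mathcal Y_j$. A maximum over an empty set is $0$ (immaterial). *)

theory Defs
  imports "HOL-Probability.Probability"
begin

text \<open>
  Points of \<open>d\<close>-dimensional space are vectors of type \<^typ>\<open>real ^ 'n\<close> with \<open>d = CARD('n)\<close>.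
  The index type carries no canonical enumeration, so the coordinates \<open>z\<^sub>1, \<dots>, z\<^sub>d\<close> are
  \<open>z $ ix 1, \<dots>, z $ ix d\<close> for a bijection \<open>ix\<close> from \<open>{1..d}\<close> to the index type. The semi-axes
  are the values \<open>a 1, \<dots>, a d\<close>.
\<close>

definition ellipsoid :: "(nat \<Rightarrow> 'n) \<Rightarrow> (nat \<Rightarrow> real) \<Rightarrow> (real ^ 'n::finite) set" where
  "ellipsoid ix a = {z. (\<Sum>j=1..CARD('n). (z $ ix j / a j)\<^sup>2) \<le> 1}"

definition paraboloid :: "(nat \<Rightarrow> 'n) \<Rightarrow> (nat \<Rightarrow> real) \<Rightarrow> (real ^ 'n::finite) set" where
  "paraboloid ix a = {z. (\<Sum>j=2..CARD('n). (z $ ix j / a j)\<^sup>2) \<le> 2 * z $ ix 1 / a 1}"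

definition max_dist :: "(nat \<Rightarrow> 'v::real_normed_vector) \<Rightarrow> nat \<Rightarrow> real" where
  "max_dist z k =
     (if k = 0 then 0 else Max ((\<lambda>(i, j). norm (z i - z j)) ` ({1..k} \<times> {1..k})))"

definition tail_diff_norm :: "(nat \<Rightarrow> 'n) \<Rightarrow> real ^ 'n::finite \<Rightarrow> real ^ 'n \<Rightarrow> real" where
  "tail_diff_norm ix x y = L2_set (\<lambda>j. x $ ix j - y $ ix j) {2..CARD('n)}"

definition pair_value :: "(nat \<Rightarrow> 'n) \<Rightarrow> (nat \<Rightarrow> real) \<Rightarrow> real ^ 'n::finite \<Rightarrow> real ^ 'n \<Rightarrow> real" where
  "pair_value ix a x y =
     x $ ix 1 + y $ ix 1 - 1 / (4 * a 1) * (tail_diff_norm ix x y)\<^sup>2"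

text \<open>
  Independence of two random elements with values in possibly different types;
  \<^const>\<open>prob_space.indep_var\<close> requires both to have the same type.
\<close>

definition indep_rv :: "'w measure \<Rightarrow> 'b measure \<Rightarrow> ('w \<Rightarrow> 'b) \<Rightarrow> 'c measure \<Rightarrow> ('w \<Rightarrow> 'c) \<Rightarrow> bool" where
  "indep_rv M S X T Y \<longleftrightarrow>
     X \<in> measurable M S \<and> Y \<in> measurable M T \<and>
     prob_space.indep_set M {X -` A \<inter> space M | A. A \<in> sets S} {Y -` B \<inter> space M | B. B \<in> sets T}"

text \<open>The random counting measure of the points \<open>X\<^sub>i\<close>, \<open>i \<ge> 1\<close>, counted with multiplicity.\<close>

definition point_count :: "(nat \<Rightarrow> 'w \<Rightarrow> 'v) \<Rightarrow> 'v set \<Rightarrow> 'w \<Rightarrow> ennreal" where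
  "point_count X B \<omega> = emeasure (count_space UNIV) {i. 1 \<le> i \<and> X i \<omega> \<in> B}"

text \<open>
  A Poisson process with intensity measure \<open>\<Lambda>\<close> whose points are enumerated as \<open>X\<^sub>1, X\<^sub>2, \<dots>\<close>
  (so \<open>\<Lambda>\<close> has infinite total mass). The Poisson weights are written out because
  \<^const>\<open>poisson_pmf\<close> is specified only for positive rates, whereas here the rate may be \<open>0\<close>.
\<close>

definition poisson_process :: "'w measure \<Rightarrow> 'v measure \<Rightarrow> (nat \<Rightarrow> 'w \<Rightarrow> 'v) \<Rightarrow> bool" where
  "poisson_process M \<Lambda> X \<longleftrightarrow>
     (\<forall>i\<ge>1. X i \<in> measurable M \<Lambda>) \<and>
     (\<forall>B\<in>sets \<Lambda>. emeasure \<Lambda> B < \<infinity> \<longrightarrow>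
        (\<forall>k. measure M {\<omega>\<in>space M. point_count X B \<omega> = of_nat k} =
             measure \<Lambda> B ^ k / fact k * exp (- measure \<Lambda> B))) \<and>
     (\<forall>B\<in>sets \<Lambda>. emeasure \<Lambda> B = \<infinity> \<longrightarrow> (AE \<omega> in M. point_count X B \<omega> = \<infinity>)) \<and>
     (\<forall>(B :: nat \<Rightarrow> 'v set) m. B ` {..<m} \<subseteq> sets \<Lambda> \<longrightarrow> disjoint_family_on B {..<m} \<longrightarrow>
        prob_space.indep_vars M (\<lambda>_. borel) (\<lambda>k. point_count X (B k)) {..<m})"

text \<open>
  Independence of two point processes means independence of their counting measures; the
  enumerations of the points need not be independent.
\<close>

definition indep_point_processes ::
    "'w measure \<Rightarrow> 'v measure \<Rightarrow> (nat \<Rightarrow> 'w \<Rightarrow> 'v) \<Rightarrow> (nat \<Rightarrow> 'w \<Rightarrow> 'v) \<Rightarrow> bool" where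
  "indep_point_processes M S X Y \<longleftrightarrow>
     prob_space.indep_var M
       (PiM (sets S) (\<lambda>_. borel)) (\<lambda>\<omega>. \<lambda>B\<in>sets S. point_count X B \<omega>)
       (PiM (sets S) (\<lambda>_. borel)) (\<lambda>\<omega>. \<lambda>B\<in>sets S. point_count Y B \<omega>)"

end

(*
  Two points of E that nearly realise the diameter 2 a_1 lie close to the two vertices (-a_1, 0, ..., 0)
  and (a_1, 0, ..., 0), because a_1 is strictly larger than the other axes. With c = n^(2/(d+1)),
  rescale a neighbourhood of each vertex by the factor c along the first axis and by sqrt c in the
  other directions. The ellipsoid then increases to the paraboloid P, volumes are multiplied by n, and
  for the rescaled points x, y of two points z, w near opposite vertices
    |z - w|^2 = 4 a_1^2 - 4 a_1 h(x, y) / c + O(1 / c^2),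
  where h(x, y) = x_1 + y_1 - |x~ - y~|^2 / (4 a_1). On P one has h(x, y) >= k (x_1 + y_1) with
  k = 1 - (a_2 / a_1)^2 > 0, so only points in a compact slab of P matter. Cover the slab by finitely
  many small cells, on pairs of which h is almost constant. The random set of cells hit by the
  rescaled sample converges in distribution to the set hit by the Poisson processes: by
  inclusion-exclusion it suffices to compare the probabilities that given cells are avoided, and
  these are (1 - q)^n or exp(-n q) on one side and a void probability on the other.
*)
theory Submission
  imports Defs
begin

text \<open>The term O(1 / c^2) is really ((x_1 + y_1) / c)^2, and it is small only while the
  rescaled points stay bounded. The lower bound for h on P alone does not ensure this, since a pair
  of sample points is selected by its distance and not by h. An estimate in the unscaled ellipsoid
  does: points whose first coordinates differ by u have squared distance at most k u^2 + 4 a_2^2,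
  which forces every nearly extremal pair into a slab that does not depend on n. Both blow-ups use
  the same sample, so the independence of the two limit processes needs a source. It is that bounded
  sets have disjoint preimages under the two rescalings once c is large; hitting probabilities then
  add, and the limits of the avoidance probabilities factorise. Continuity of the limit law is never
  established. At a continuity point t the distribution functions are squeezed between the levels t
  - \<epsilon> and t + \<epsilon>, half of \<epsilon> paying for the cell size and half for the
  error at finite n. The index \<open>e\<close> stands for the coordinate of the long axis and
  \<open>\<beta>\<close> for a_2.\<close>

locale dominant_axis =
  fixes e :: "'n::finite" and b :: "'n \<Rightarrow> real" and \<beta> :: real
  assumes axes_pos: "\<And>i. 0 < b i"
    and axes_le: "\<And>i. i \<noteq> e \<Longrightarrow> b i \<le> \<beta>"
    and bound_pos: "0 < \<beta>"
    and bound_less: "\<beta> < b e"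
begin

section \<open>Geometry at the two ends of the long axis\<close>

definition tail_form :: "real ^ 'n \<Rightarrow> real" where
  "tail_form x = (\<Sum>i\<in>-{e}. (x $ i / b i)\<^sup>2)"

definition solid :: "(real ^ 'n) set" where
  "solid = {z. (z $ e / b e)\<^sup>2 + tail_form z \<le> 1}"

definition parab :: "(real ^ 'n) set" where
  "parab = {x. tail_form x \<le> 2 * x $ e / b e}"

text \<open>The ellipsoid seen through the rescaling \<open>zoom\<close>.\<close>

definition zoomed :: "real \<Rightarrow> (real ^ 'n) set" where
  "zoomed c = {x. tail_form x \<le> 2 * x $ e / b e - (x $ e)\<^sup>2 / (c * (b e)\<^sup>2)}"

text \<open>For \<open>\<sigma> = 1\<close> this blows up a neighbourhood of the vertex with \<open>e\<close>-coordinate \<open>- b e\<close>, for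
  \<open>\<sigma> = -1\<close> a neighbourhood of the opposite vertex.\<close>

definition zoom :: "real \<Rightarrow> real \<Rightarrow> real ^ 'n \<Rightarrow> real ^ 'n" where
  "zoom \<sigma> c z = (\<chi> i. if i = e then c * (b e + \<sigma> * z $ e) else sqrt c * z $ i)"

definition unzoom :: "real \<Rightarrow> real \<Rightarrow> real ^ 'n \<Rightarrow> real ^ 'n" where
  "unzoom \<sigma> c x = (\<chi> i. if i = e then \<sigma> * (x $ e / c - b e) else x $ i / sqrt c)"

text \<open>This is the function h of the overview: to leading order in 1 / c it is c times the
  amount by which the distance of two points falls short of \<open>2 * b e\<close>.\<close>

definition gap :: "real ^ 'n \<Rightarrow> real ^ 'n \<Rightarrow> real" where
  "gap x y = x $ e + y $ e - (\<Sum>i\<in>-{e}. (x $ i - y $ i)\<^sup>2) / (4 * b e)"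

text \<open>The square of the classical eccentricity of an ellipse with semi-axes \<open>b e\<close>
  and \<open>\<beta>\<close>; it is the constant k of the overview.\<close>

definition eccentricity :: real where
  "eccentricity = 1 - \<beta>\<^sup>2 / (b e)\<^sup>2"

lemma axes_nonzero [simp]: "b i \<noteq> 0"
  using axes_pos[of i] by simp

lemma eccentricity_pos: "0 < eccentricity"
  using bound_pos bound_less axes_pos[of e]
  by (simp add: eccentricity_def field_simps power_strict_mono)

lemma tail_form_nonneg: "0 \<le> tail_form x"
  by (simp add: tail_form_def sum_nonneg)

lemma parab_axis_nonneg: "x \<in> parab \<Longrightarrow> 0 \<le> x $ e"
proof -
  assume "x \<in> parab"
  then have "0 \<le> 2 * x $ e / b e" using tail_form_nonneg[of x] by (simp add: parab_def)
  then show ?thesis using axes_pos[of e] by (simp add: zero_le_divide_iff)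
qed

lemma zoomed_subset_parab: "0 < c \<Longrightarrow> zoomed c \<subseteq> parab"
proof
  fix x assume c: "0 < c" and "x \<in> zoomed c"
  moreover have "0 \<le> (x $ e)\<^sup>2 / (c * (b e)\<^sup>2)" using c by simp
  ultimately show "x \<in> parab" unfolding zoomed_def parab_def mem_Collect_eq by linarith
qed

lemma norm_sq_split: "(norm z)\<^sup>2 = (z $ e)\<^sup>2 + (\<Sum>i\<in>-{e}. (z $ i)\<^sup>2)"
proof -
  have "(norm z)\<^sup>2 = (\<Sum>i\<in>UNIV. (z $ i)\<^sup>2)"
    by (simp add: norm_vec_def L2_set_def sum_nonneg)
  also have "\<dots> = (z $ e)\<^sup>2 + (\<Sum>i\<in>UNIV - {e}. (z $ i)\<^sup>2)"
    by (rule sum.remove) auto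
  finally show ?thesis by (simp add: Compl_eq_Diff_UNIV)
qed

lemma tail_sq_le: "(\<Sum>i\<in>-{e}. (x $ i)\<^sup>2) \<le> \<beta>\<^sup>2 * tail_form x"
  unfolding tail_form_def sum_distrib_left
proof (rule sum_mono)
  fix i assume "i \<in> -{e}"
  then have "b i \<le> \<beta>" using axes_le by auto
  then have "(b i)\<^sup>2 \<le> \<beta>\<^sup>2" using axes_pos[of i] by (intro power_mono) auto
  then have "(b i)\<^sup>2 * (x $ i / b i)\<^sup>2 \<le> \<beta>\<^sup>2 * (x $ i / b i)\<^sup>2" by (rule mult_right_mono) simp
  then show "(x $ i)\<^sup>2 \<le> \<beta>\<^sup>2 * (x $ i / b i)\<^sup>2"
    using axes_pos[of i] by (simp add: power_divide)
qed

text \<open>The bound (s - t)^2 <= 2 s^2 + 2 t^2 loses nothing when the two tails are opposite. A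
  larger constant would not leave a positive coefficient in \<open>gap_ge\<close> for every
  \<open>\<beta>\<close> below \<open>b e\<close>.\<close>

lemma tail_diff_sq_le:
  "(\<Sum>i\<in>-{e}. (x $ i - y $ i)\<^sup>2) \<le> 2 * \<beta>\<^sup>2 * (tail_form x + tail_form y)"
proof -
  have "(\<Sum>i\<in>-{e}. (x $ i - y $ i)\<^sup>2) \<le> (\<Sum>i\<in>-{e}. 2 * (x $ i)\<^sup>2 + 2 * (y $ i)\<^sup>2)"
  proof (rule sum_mono)
    fix i
    show "(x $ i - y $ i)\<^sup>2 \<le> 2 * (x $ i)\<^sup>2 + 2 * (y $ i)\<^sup>2"
      using zero_le_power2[of "x $ i + y $ i"] by (simp add: power2_eq_square algebra_simps)
  qed
  also have "\<dots> = 2 * (\<Sum>i\<in>-{e}. (x $ i)\<^sup>2) + 2 * (\<Sum>i\<in>-{e}. (y $ i)\<^sup>2)"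
    by (simp add: sum.distrib sum_distrib_left)
  also have "\<dots> \<le> 2 * (\<beta>\<^sup>2 * tail_form x) + 2 * (\<beta>\<^sup>2 * tail_form y)"
    using tail_sq_le[of x] tail_sq_le[of y] by linarith
  finally show ?thesis by (simp add: algebra_simps)
qed

text \<open>On the paraboloid \<open>tail_form\<close> is at most linear in the axis coordinate, so
  the quadratic term subtracted in \<open>gap\<close> consumes at most the proportion
  \<open>\<beta>^2 / (b e)^2\<close> of the linear part. Small values of \<open>gap\<close>
  therefore confine both points to a slab.\<close>

lemma gap_ge:
  assumes "x \<in> parab" "y \<in> parab"
  shows "eccentricity * (x $ e + y $ e) \<le> gap x y"
proof -
  have "2 * \<beta>\<^sup>2 * (tail_form x + tail_form y) \<le> 2 * \<beta>\<^sup>2 * (2 * x $ e / b e + 2 * y $ e / b e)"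
    using assms by (intro mult_left_mono add_mono) (simp_all add: parab_def)
  with tail_diff_sq_le[of x y]
  have "(\<Sum>i\<in>-{e}. (x $ i - y $ i)\<^sup>2) \<le> 2 * \<beta>\<^sup>2 * (2 * x $ e / b e + 2 * y $ e / b e)"
    by linarith
  then have "(\<Sum>i\<in>-{e}. (x $ i - y $ i)\<^sup>2) / (4 * b e)
      \<le> 2 * \<beta>\<^sup>2 * (2 * x $ e / b e + 2 * y $ e / b e) / (4 * b e)"
    using axes_pos[of e] by (intro divide_right_mono) auto
  also have "\<dots> = \<beta>\<^sup>2 / (b e)\<^sup>2 * (x $ e + y $ e)"
    using axes_pos[of e] by (simp add: field_simps power2_eq_square)
  finally show ?thesis by (simp add: gap_def eccentricity_def algebra_simps)
qed

text \<open>Put t = \<sigma> z_e. At the axis coordinate c (b_e + t) the right-hand side in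
  \<open>zoomed\<close> becomes c (1 - (t / b_e)^2), and the tail form also scales by c, so c
  cancels. The sign \<sigma> disappears in the square.\<close>

lemma zoom_in_zoomed_iff:
  assumes c: "0 < c" and \<sigma>: "\<sigma>\<^sup>2 = 1"
  shows "zoom \<sigma> c z \<in> zoomed c \<longleftrightarrow> z \<in> solid"
proof -
  have tail: "tail_form (zoom \<sigma> c z) = c * tail_form z"
    unfolding tail_form_def zoom_def sum_distrib_left
    by (rule sum.cong) (use c in \<open>auto simp: power_divide power_mult_distrib\<close>)
  define t where "t = \<sigma> * z $ e"
  have t2: "(z $ e)\<^sup>2 = t\<^sup>2" using \<sigma> by (simp add: t_def power_mult_distrib)
  have ax: "zoom \<sigma> c z $ e = c * (b e + t)" by (simp add: zoom_def t_def)
  have "2 * (c * (b e + t)) / b e - (c * (b e + t))\<^sup>2 / (c * (b e)\<^sup>2) = c * (1 - (t / b e)\<^sup>2)"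
    using c axes_pos[of e] by (simp add: field_simps power2_eq_square)
  then have "zoom \<sigma> c z \<in> zoomed c \<longleftrightarrow> c * tail_form z \<le> c * (1 - (t / b e)\<^sup>2)"
    by (simp add: zoomed_def tail ax)
  also have "\<dots> \<longleftrightarrow> tail_form z \<le> 1 - (t / b e)\<^sup>2" using c by simp
  finally show ?thesis by (auto simp: solid_def power_divide t2)
qed

lemma zoom_unzoom:
  assumes "0 < c" and "\<sigma>\<^sup>2 = 1"
  shows "zoom \<sigma> c (unzoom \<sigma> c x) = x"
proof -
  have sq: "\<sigma> * (\<sigma> * r) = r" for r
    using assms(2) by (metis mult.assoc mult_1 power2_eq_square)
  show ?thesis using assms(1) by (simp add: zoom_def unzoom_def vec_eq_iff sq)
qed

text \<open>An identity, not an approximation: the axis difference of z and w is (x_e + y_e) / c - 2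
  b_e, whose square produces the constant, a linear term and the last summand. The squared tail
  distance scales by 1 / c and joins the linear term to form \<open>gap\<close>.\<close>

lemma dist_sq_zoom:
  fixes z w :: "real ^ 'n"
  assumes c: "0 < c"
  defines "x \<equiv> zoom 1 c z" and "y \<equiv> zoom (-1) c w"
  shows "(norm (z - w))\<^sup>2 = 4 * (b e)\<^sup>2 - 4 * b e * gap x y / c + ((x $ e + y $ e) / c)\<^sup>2"
proof -
  define S where "S = (\<Sum>i\<in>-{e}. (z $ i - w $ i)\<^sup>2)"
  have "(\<Sum>i\<in>-{e}. (x $ i - y $ i)\<^sup>2) = c * S"
    unfolding S_def sum_distrib_left x_def y_def zoom_def
    by (rule sum.cong) (use c in \<open>auto simp: power_mult_distrib simp flip: right_diff_distrib\<close>)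
  then have gap: "gap x y = x $ e + y $ e - c * S / (4 * b e)" by (simp add: gap_def)
  have s: "x $ e + y $ e = c * (2 * b e + (z $ e - w $ e))"
    by (simp add: x_def y_def zoom_def algebra_simps)
  have "(norm (z - w))\<^sup>2 = (z $ e - w $ e)\<^sup>2 + S"
    by (simp add: norm_sq_split S_def)
  moreover have "4 * b e * gap x y / c = 4 * b e * (2 * b e + (z $ e - w $ e)) - S"
    unfolding gap s using c axes_pos[of e] by (simp add: field_simps)
  moreover have "((x $ e + y $ e) / c)\<^sup>2 = (2 * b e + (z $ e - w $ e))\<^sup>2" using s c by simp
  ultimately show ?thesis by (simp only:) (simp add: power2_eq_square algebra_simps)
qed

lemma axis_bounds:
  assumes "z \<in> solid"
  shows "\<bar>z $ e\<bar> \<le> b e"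
proof -
  have "(z $ e / b e)\<^sup>2 \<le> 1" using assms tail_form_nonneg[of z] by (simp add: solid_def)
  then have "\<bar>z $ e / b e\<bar> \<le> 1" by (simp add: abs_square_le_1)
  then show ?thesis using axes_pos[of e] by (simp add: abs_divide)
qed

text \<open>Adding the two ellipsoid inequalities leaves at most 2 - u^2 / (2 b_e^2) for the two
  tail forms together, u being the axis separation. At u = 2 b_e the bound equals 4 b_e^2, so a
  distance close to the diameter forces a separation close to 2 b_e.\<close>

lemma norm_diff_sq_le:
  assumes z: "z \<in> solid" and w: "w \<in> solid"
  shows "(norm (z - w))\<^sup>2 \<le> eccentricity * (z $ e - w $ e)\<^sup>2 + 4 * \<beta>\<^sup>2"
proof -
  define u where "u = z $ e - w $ e"
  have uu: "u\<^sup>2 \<le> 2 * ((z $ e)\<^sup>2 + (w $ e)\<^sup>2)"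
    using zero_le_power2[of "z $ e + w $ e"] by (simp add: u_def power2_eq_square algebra_simps)
  have be: "0 < b e" by (rule axes_pos)
  have "tail_form z + tail_form w \<le> 2 - ((z $ e)\<^sup>2 + (w $ e)\<^sup>2) / (b e)\<^sup>2"
    using z w by (simp add: solid_def power_divide add_divide_distrib)
  also have "\<dots> \<le> 2 - u\<^sup>2 / 2 / (b e)\<^sup>2"
    using uu by (intro diff_left_mono divide_right_mono) auto
  finally have "2 * \<beta>\<^sup>2 * (tail_form z + tail_form w) \<le> 2 * \<beta>\<^sup>2 * (2 - u\<^sup>2 / 2 / (b e)\<^sup>2)"
    by (intro mult_left_mono) auto
  also have "\<dots> = 4 * \<beta>\<^sup>2 - \<beta>\<^sup>2 / (b e)\<^sup>2 * u\<^sup>2" by (simp add: field_simps)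
  finally have "(norm (z - w))\<^sup>2 \<le> u\<^sup>2 + (4 * \<beta>\<^sup>2 - \<beta>\<^sup>2 / (b e)\<^sup>2 * u\<^sup>2)"
    using tail_diff_sq_le[of z w] by (simp add: norm_sq_split u_def)
  then show ?thesis by (simp add: eccentricity_def u_def algebra_simps)
qed

text \<open>With u the axis separation and v = 2 b_e - u, \<open>norm_diff_sq_le\<close> yields k (4
  b_e v - v^2) <= 4 b_e r / c. The hypothesis \<open>order\<close> makes u nonnegative, hence v <= 2
  b_e and v^2 <= 2 b_e v; this excludes the large solutions of the quadratic inequality and leaves c
  v <= 2 r / k. The sum of the axis coordinates after zooming is c v.\<close>

lemma zoom_axis_sum_le:
  assumes c: "0 < c" and z: "z \<in> solid" and w: "w \<in> solid"
    and order: "z $ e \<le> w $ e"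
    and far: "2 * b e - r / c \<le> norm (z - w)" and rc: "r / c \<le> 2 * b e"
  shows "zoom 1 c z $ e + zoom (-1) c w $ e \<le> 2 * r / eccentricity"
proof -
  define u where "u = w $ e - z $ e"
  define v where "v = 2 * b e - u"
  define k where "k = eccentricity"
  have k: "0 < k" "k * (b e)\<^sup>2 = (b e)\<^sup>2 - \<beta>\<^sup>2"
    using eccentricity_pos axes_pos[of e] by (auto simp: k_def eccentricity_def field_simps)
  have be: "0 < b e" by (rule axes_pos)
  have u: "0 \<le> u" "u \<le> 2 * b e" using order axis_bounds[OF z] axis_bounds[OF w]
    by (auto simp: u_def)
  have "(2 * b e - r / c)\<^sup>2 \<le> (norm (z - w))\<^sup>2"
    using far rc by (intro power_mono) auto
  moreover have "(2 * b e - r / c)\<^sup>2 = 4 * (b e)\<^sup>2 - 4 * b e * r / c + (r / c)\<^sup>2"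
    by (simp add: power2_eq_square algebra_simps)
  moreover have "(norm (z - w))\<^sup>2 \<le> k * u\<^sup>2 + 4 * \<beta>\<^sup>2"
    using norm_diff_sq_le[OF z w] by (simp add: u_def k_def power2_commute)
  moreover have "0 \<le> (r / c)\<^sup>2" by simp
  ultimately have "4 * (b e)\<^sup>2 - 4 * b e * r / c \<le> k * u\<^sup>2 + 4 * \<beta>\<^sup>2" by linarith
  also have "k * u\<^sup>2 = k * (4 * (b e)\<^sup>2 - 4 * b e * v + v\<^sup>2)"
    by (simp add: v_def power2_eq_square algebra_simps)
  also have "\<dots> = 4 * (b e)\<^sup>2 - 4 * \<beta>\<^sup>2 - k * (4 * b e * v - v\<^sup>2)"
    using k(2) by (simp add: algebra_simps)
  finally have A: "k * (4 * b e * v - v\<^sup>2) \<le> 4 * b e * r / c" by simp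
  have "v\<^sup>2 \<le> 2 * b e * v"
    using u by (simp add: v_def power2_eq_square mult_right_mono)
  then have "k * (2 * b e * v) \<le> k * (4 * b e * v - v\<^sup>2)"
    using k(1) by (intro mult_left_mono) linarith+
  with A have "2 * b e * (k * v) \<le> 2 * b e * (2 * r / c)" by (simp only: mult_ac times_divide_eq_right)
  then have "k * v \<le> 2 * r / c" by (rule mult_left_le_imp_le) (use be in simp)
  then have "c * v \<le> 2 * r / k" using c k(1) by (simp add: field_simps)
  moreover have "zoom 1 c z $ e + zoom (-1) c w $ e = c * v"
    by (simp add: zoom_def v_def u_def algebra_simps)
  ultimately show ?thesis by (simp add: k_def)
qed

text \<open>The lower bound on the distance, squared and compared with \<open>dist_sq_zoom\<close>,
  gives h <= r + s^2 / (4 b_e c) for the value h of \<open>gap\<close> and the sum s of the axis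
  coordinates. Then \<open>zoom_axis_sum_le\<close> makes the correction vanish uniformly as c
  grows.\<close>

lemma far_pair_gap_le:
  assumes c: "0 < c" and z: "z \<in> solid" and w: "w \<in> solid"
    and order: "z $ e \<le> w $ e"
    and far: "2 * b e - r / c \<le> norm (z - w)" and rc: "r / c \<le> 2 * b e"
  shows "gap (zoom 1 c z) (zoom (-1) c w) \<le> r + (2 * r / eccentricity)\<^sup>2 / (4 * b e * c)"
proof -
  define s where "s = zoom 1 c z $ e + zoom (-1) c w $ e"
  define h where "h = gap (zoom 1 c z) (zoom (-1) c w)"
  have be: "0 < b e" by (rule axes_pos)
  have "zoom 1 c z \<in> parab" "zoom (-1) c w \<in> parab"
    using zoomed_subset_parab[OF c] zoom_in_zoomed_iff[OF c, of 1 z] zoom_in_zoomed_iff[OF c, of "-1" w] z w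
    by auto
  then have "0 \<le> s" using parab_axis_nonneg by (fastforce simp: s_def)
  moreover have "s \<le> 2 * r / eccentricity" using zoom_axis_sum_le[OF assms] by (simp add: s_def)
  ultimately have s: "s\<^sup>2 \<le> (2 * r / eccentricity)\<^sup>2" by (intro power_mono) auto
  have "(2 * b e - r / c)\<^sup>2 \<le> (norm (z - w))\<^sup>2"
    using far rc by (intro power_mono) auto
  moreover have "(2 * b e - r / c)\<^sup>2 = 4 * (b e)\<^sup>2 - 4 * b e * r / c + (r / c)\<^sup>2"
    by (simp add: power2_eq_square algebra_simps)
  moreover have "(norm (z - w))\<^sup>2 = 4 * (b e)\<^sup>2 - 4 * b e * h / c + (s / c)\<^sup>2"
    using dist_sq_zoom[OF c, of z w] by (simp add: s_def h_def)
  moreover have "0 \<le> (r / c)\<^sup>2" by simp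
  ultimately have "4 * b e * h / c \<le> 4 * b e * r / c + (s / c)\<^sup>2" by linarith
  then have "4 * b e * c * h \<le> 4 * b e * c * r + s\<^sup>2"
    using c by (simp add: field_simps power2_eq_square)
  moreover have "4 * b e * c * (r + s\<^sup>2 / (4 * b e * c)) = 4 * b e * c * r + s\<^sup>2"
    using c be by (simp add: field_simps)
  ultimately have "4 * b e * c * h \<le> 4 * b e * c * (r + s\<^sup>2 / (4 * b e * c))" by linarith
  then have "h \<le> r + s\<^sup>2 / (4 * b e * c)" using c be by simp
  moreover have "s\<^sup>2 / (4 * b e * c) \<le> (2 * r / eccentricity)\<^sup>2 / (4 * b e * c)"
    using s c be by (intro divide_right_mono) auto
  ultimately show ?thesis by (simp add: h_def)
qed

text \<open>The correction \<open>r^2 / (4 * b e * c)\<close> is exactly what turns the upper bound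
  on \<open>gap\<close> into the square of 2 b_e - r / c. The last summand of
  \<open>dist_sq_zoom\<close> is nonnegative and helps here, so z and w may lie anywhere.\<close>

lemma far_pair_if_gap_le:
  assumes c: "0 < c"
    and gap: "gap (zoom 1 c z) (zoom (-1) c w) \<le> r - r\<^sup>2 / (4 * b e * c)"
  shows "2 * b e - r / c \<le> norm (z - w)"
proof -
  define h where "h = gap (zoom 1 c z) (zoom (-1) c w)"
  have be: "0 < b e" by (rule axes_pos)
  have "4 * b e * h / c \<le> 4 * b e * (r - r\<^sup>2 / (4 * b e * c)) / c"
    using gap be c unfolding h_def by (intro divide_right_mono mult_left_mono) auto
  also have "\<dots> = 4 * b e * r / c - (r / c)\<^sup>2"
    using be c by (simp add: field_simps power2_eq_square)
  finally have "(2 * b e - r / c)\<^sup>2 \<le> 4 * (b e)\<^sup>2 - 4 * b e * h / c"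
    by (simp add: power2_eq_square algebra_simps)
  also have "\<dots> \<le> (norm (z - w))\<^sup>2"
    using dist_sq_zoom[OF c, of z w] by (simp add: h_def)
  finally show ?thesis by (rule power2_le_imp_le) simp
qed

end


section \<open>Volumes of the ellipsoid and of its rescalings\<close>

text \<open>The change of variables for diagonal affine maps, translated from sums over
  \<open>Basis\<close> to coordinates of vectors. It serves both the volume of the ellipsoid and the
  Jacobian of the rescaling.\<close>

lemma emeasure_lborel_diagonal_affine:
  fixes k :: "'n::finite \<Rightarrow> real" and t :: "real ^ 'n"
  assumes k: "\<And>i. k i \<noteq> 0" and A: "A \<in> sets borel"
  shows "emeasure lborel A
       = ennreal (\<Prod>i\<in>UNIV. \<bar>k i\<bar>) * emeasure lborel {x. (\<chi> i. t $ i + k i * x $ i) \<in> A}"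
proof -
  define v :: "real ^ 'n" where "v = (\<chi> i. k i)"
  define T where "T x = t + (\<Sum>j\<in>Basis. ((v \<bullet> j) * (x \<bullet> j)) *\<^sub>R j)" for x :: "real ^ 'n"
  have basis: "Basis = range (\<lambda>i::'n. axis i (1::real))"
    by (auto simp: Basis_vec_def)
  have inj: "inj (\<lambda>i::'n. axis i (1::real))" by (auto simp: inj_def axis_eq_axis)
  have T: "T x = (\<chi> i. t $ i + k i * x $ i)" for x
  proof -
    have "(\<Sum>j\<in>Basis. ((v \<bullet> j) * (x \<bullet> j)) *\<^sub>R j) $ i = k i * x $ i" for i
    proof -
      have "(\<Sum>j\<in>Basis. ((v \<bullet> j) * (x \<bullet> j)) *\<^sub>R j) \<bullet> axis i 1 = (v \<bullet> axis i 1) * (x \<bullet> axis i 1)"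
        by (rule inner_sum_left_Basis) (simp add: basis)
      then show ?thesis by (simp add: inner_axis v_def)
    qed
    then show ?thesis by (simp add: T_def vec_eq_iff)
  qed
  have "lborel = density (distr lborel borel T) (\<lambda>_. (\<Prod>j\<in>Basis. \<bar>v \<bullet> j\<bar>))"
    unfolding T_def by (rule lborel_affine_euclidean) (auto simp: basis inner_axis v_def k)
  moreover have "(\<Prod>j\<in>Basis. \<bar>v \<bullet> j\<bar>) = (\<Prod>i\<in>UNIV. \<bar>k i\<bar>)"
    unfolding basis by (subst prod.reindex[OF inj]) (simp add: inner_axis v_def)
  moreover have meas: "T \<in> borel_measurable borel" unfolding T_def by measurable
  ultimately have "emeasure lborel A
      = emeasure (density (distr lborel borel T) (\<lambda>_. ennreal (\<Prod>i\<in>UNIV. \<bar>k i\<bar>))) A"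
    by simp
  also have "\<dots> = ennreal (\<Prod>i\<in>UNIV. \<bar>k i\<bar>) * emeasure lborel (T -` A)"
    using A meas by (simp add: emeasure_density nn_integral_cmult_indicator emeasure_distr)
  finally show ?thesis by (simp add: T vimage_def)
qed

context dominant_axis
begin

lemma tail_form_measurable [measurable]: "tail_form \<in> borel_measurable borel"
  unfolding tail_form_def by measurable

lemma borel_sets [measurable]:
  "solid \<in> sets borel" "parab \<in> sets borel" "zoomed c \<in> sets borel"
  unfolding solid_def parab_def zoomed_def by measurable


lemma zoom_measurable [measurable]: "zoom \<sigma> c \<in> borel_measurable borel"
proof (rule borel_measurable_continuous_onI)
  have "continuous_on UNIV (\<lambda>z. if i = e then c * (b e + \<sigma> * z $ e) else sqrt c * z $ i)" for i
    by (cases "i = e") (auto intro!: continuous_intros)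
  then show "continuous_on UNIV (zoom \<sigma> c)"
    unfolding zoom_def by (intro continuous_intros)
qed

text \<open>The diagonal map with entries \<open>b i\<close> carries the unit ball onto
  \<open>solid\<close>.\<close>

lemma emeasure_solid:
  "emeasure lborel solid
     = ennreal (unit_ball_vol (real CARD('n)) * (\<Prod>i\<in>UNIV. b i))"
proof -
  have "(\<chi> i. 0 $ i + b i * x $ i) \<in> solid \<longleftrightarrow> x \<in> cball 0 1" for x :: "real ^ 'n"
  proof -
    define y :: "real ^ 'n" where "y = (\<chi> i. 0 $ i + b i * x $ i)"
    have y: "y $ i / b i = x $ i" for i by (simp add: y_def)
    have "y \<in> solid \<longleftrightarrow> (norm x)\<^sup>2 \<le> 1"
      unfolding solid_def tail_form_def mem_Collect_eq y norm_sq_split ..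
    also have "\<dots> \<longleftrightarrow> norm x \<le> 1" by (simp only: abs_square_le_1 abs_norm_cancel)
    finally show ?thesis by (simp add: y_def)
  qed
  then have "{x. (\<chi> i. 0 $ i + b i * x $ i) \<in> solid} = cball 0 1"
    by (simp only: Collect_mem_eq)
  then have "emeasure lborel solid
      = ennreal (\<Prod>i\<in>UNIV. \<bar>b i\<bar>) * emeasure lborel (cball 0 1 :: (real ^ 'n) set)"
    using emeasure_lborel_diagonal_affine[of b solid 0] borel_sets(1) axes_nonzero by simp
  also have "\<dots> = ennreal (\<Prod>i\<in>UNIV. b i) * ennreal (unit_ball_vol (real CARD('n)))"
    using axes_pos by (simp add: emeasure_cball less_imp_le)
  finally show ?thesis
    using axes_pos by (simp add: ennreal_mult[symmetric] prod_nonneg less_imp_le mult.commute)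
qed

text \<open>The inverse rescaling \<open>unzoom\<close> shrinks the long axis by c and each of the
  other d - 1 coordinates by sqrt c, so its Jacobian is 1 / c^((d + 1) / 2). The sign \<sigma> and
  the translation do not affect volumes.\<close>

lemma emeasure_solid_zoom_vimage:
  assumes c: "0 < c" and \<sigma>: "\<sigma>\<^sup>2 = 1" and U: "U \<in> sets borel"
  shows "emeasure lborel (solid \<inter> zoom \<sigma> c -` U)
       = ennreal (c powr (- (real CARD('n) + 1) / 2)) * emeasure lborel (zoomed c \<inter> U)"
proof -
  define k where "k i = (if i = e then \<sigma> / c else 1 / sqrt c)" for i
  define t :: "real ^ 'n" where "t = (\<chi> i. if i = e then - \<sigma> * b e else 0)"
  have abs\<sigma>: "\<bar>\<sigma>\<bar> = 1" using \<sigma> by (simp add: power2_eq_1_iff) (auto simp: power2_eq_1_iff)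
  have eq: "(\<chi> i. t $ i + k i * x $ i) = unzoom \<sigma> c x" for x
    by (simp add: unzoom_def vec_eq_iff t_def k_def algebra_simps)
  have "unzoom \<sigma> c x \<in> solid \<inter> zoom \<sigma> c -` U \<longleftrightarrow> x \<in> zoomed c \<inter> U" for x
    using zoom_in_zoomed_iff[OF c \<sigma>, of "unzoom \<sigma> c x"] by (simp add: zoom_unzoom[OF c \<sigma>])
  then have "{x. (\<chi> i. t $ i + k i * x $ i) \<in> solid \<inter> zoom \<sigma> c -` U} = zoomed c \<inter> U"
    unfolding eq by blast
  moreover have "k i \<noteq> 0" for i using c abs\<sigma> by (auto simp: k_def)
  moreover have "solid \<inter> zoom \<sigma> c -` U \<in> sets borel"
    using U measurable_sets[OF zoom_measurable, of U] by auto
  moreover have "(\<Prod>i\<in>UNIV. \<bar>k i\<bar>) = c powr (- (real CARD('n) + 1) / 2)"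
  proof -
    have "(\<Prod>i\<in>UNIV. \<bar>k i\<bar>) = \<bar>k e\<bar> * (\<Prod>i\<in>UNIV - {e}. \<bar>k i\<bar>)"
      by (rule prod.remove) auto
    also have "(\<Prod>i\<in>UNIV - {e}. \<bar>k i\<bar>) = (\<Prod>i\<in>UNIV - {e}. c powr (-1/2))"
    proof (rule prod.cong)
      have "1 / sqrt c = c powr (-1/2)"
        using c powr_half_sqrt[of c] powr_minus_divide[of c "1/2"] by simp
      then show "\<bar>k i\<bar> = c powr (-1/2)" if "i \<in> UNIV - {e}" for i
        using that c by (simp add: k_def)
    qed simp
    also have "\<dots> = (c powr (-1/2)) ^ (CARD('n) - 1)"
      by (simp add: card_Diff_singleton)
    also have "\<dots> = (c powr (-1/2)) powr real (CARD('n) - 1)"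
      using c by (intro powr_realpow[symmetric]) simp
    also have "real (CARD('n) - 1) = real CARD('n) - 1"
      by (simp add: of_nat_diff Suc_leI)
    also have "(c powr (-1/2)) powr (real CARD('n) - 1) = c powr (- (real CARD('n) - 1) / 2)"
    proof -
      have "(-1/2) * u = - u / 2" for u :: real by simp
      then show ?thesis by (simp only: powr_powr)
    qed
    also have "\<bar>k e\<bar> = c powr (-1)" using c abs\<sigma> by (simp add: k_def powr_minus abs_divide inverse_eq_divide)
    also have "c powr (-1) * c powr (- (real CARD('n) - 1) / 2)
        = c powr (-1 + - (real CARD('n) - 1) / 2)"
      by (rule powr_add[symmetric])
    also have "-1 + - (real CARD('n) - 1) / 2 = - (real CARD('n) + 1) / 2"
      by (simp add: field_simps)
    finally show ?thesis .
  qed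
  ultimately show ?thesis
    using emeasure_lborel_diagonal_affine[of k "solid \<inter> zoom \<sigma> c -` U" t] by simp
qed

lemma zoomed_mono:
  assumes "0 < c" "c \<le> c'"
  shows "zoomed c \<subseteq> zoomed c'"
proof
  fix x assume "x \<in> zoomed c"
  moreover have "(x $ e)\<^sup>2 / (c' * (b e)\<^sup>2) \<le> (x $ e)\<^sup>2 / (c * (b e)\<^sup>2)"
    using assms axes_pos[of e] by (intro divide_left_mono mult_right_mono mult_pos_pos) auto
  ultimately show "x \<in> zoomed c'" unfolding zoomed_def mem_Collect_eq by linarith
qed

text \<open>A ray from a point inside the paraboloid leaves it exactly once.\<close>

lemma negligible_parab_boundary: "negligible {x. tail_form x = 2 * x $ e / b e}"
proof (rule starlike_negligible[where a = "axis e 1"])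
  have "continuous_on UNIV (\<lambda>x. tail_form x)" "continuous_on UNIV (\<lambda>x::real^'n. 2 * x $ e / b e)"
    unfolding tail_form_def by (auto intro!: continuous_intros)
  then show "closed {x. tail_form x = 2 * x $ e / b e}" by (rule closed_Collect_eq)
next
  fix s :: real and x :: "real ^ 'n"
  assume s: "0 \<le> s" and "axis e 1 + s *\<^sub>R x \<in> {x. tail_form x = 2 * x $ e / b e}"
    and "axis e 1 + x \<in> {x. tail_form x = 2 * x $ e / b e}"
  moreover have "tail_form (axis e 1 + u *\<^sub>R x) = u\<^sup>2 * tail_form x" for u
    unfolding tail_form_def sum_distrib_left
    by (rule sum.cong) (auto simp: axis_def power_mult_distrib power_divide)
  from this this[of 1]
  have "tail_form (axis e 1 + u *\<^sub>R x) = u\<^sup>2 * tail_form x"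
       "tail_form (axis e 1 + x) = tail_form x" for u by simp_all
  ultimately have "s\<^sup>2 * tail_form x = 2 * (1 + s * x $ e) / b e" "tail_form x = 2 * (1 + x $ e) / b e"
    by (auto simp: axis_def)
  then have "s\<^sup>2 * (2 * (1 + x $ e)) = 2 * (1 + s * x $ e)"
    using axes_pos[of e] by (simp add: field_simps)
  \<comment> \<open>The second factor is positive, because nonnegativity of the tail form at the
    second boundary point gives 1 + x_e >= 0. Hence s = 1.\<close>
  then have "(s - 1) * (s * (1 + x $ e) + 1) = 0" by (simp add: power2_eq_square algebra_simps)
  moreover have "0 \<le> 2 * (1 + x $ e) / b e"
    using \<open>tail_form x = _\<close> tail_form_nonneg[of x] by simp
  then have "0 \<le> 1 + x $ e" using axes_pos[of e] by (simp add: zero_le_divide_iff)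
  with s have "0 \<le> s * (1 + x $ e)" by simp
  ultimately show "s = 1" by auto
qed

text \<open>The sets \<open>zoomed c\<close> increase with c and exhaust the points of the
  paraboloid where the defining inequality is strict; what may be missing lies in its boundary, a
  null set. Continuity from below then gives the limit, boundedness of \<open>U\<close> keeping the
  measures finite.\<close>

lemma measure_zoomed_tendsto:
  assumes U: "U \<in> sets borel" and fin: "bounded U" and r: "0 < r"
  shows "(\<lambda>n. measure lborel (zoomed (real n powr r) \<inter> U)) \<longlonglongrightarrow> measure lborel (parab \<inter> U)"
proof -
  \<comment> \<open>The shift to \<open>Suc n\<close> matters: at n = 0 the factor is 0 and division
    by 0 gives 0, so \<open>zoomed 0\<close> is all of \<open>parab\<close> and monotonicity would
    fail.\<close>
  define A where "A n = zoomed (real (Suc n) powr r) \<inter> U" for n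
  have A: "range A \<subseteq> sets lborel" using U by (auto simp: A_def)
  have "incseq A"
  proof (rule incseq_SucI)
    fix n
    have "real (Suc n) powr r \<le> real (Suc (Suc n)) powr r"
      using r by (intro powr_mono2) auto
    then have "zoomed (real (Suc n) powr r) \<subseteq> zoomed (real (Suc (Suc n)) powr r)"
      by (intro zoomed_mono) auto
    then show "A n \<subseteq> A (Suc n)" by (auto simp: A_def)
  qed
  have UA: "(\<Union>n. A n) \<subseteq> parab \<inter> U"
  proof -
    have "zoomed (real (Suc n) powr r) \<subseteq> parab" for n
      by (rule zoomed_subset_parab) simp
    then show ?thesis unfolding A_def by blast
  qed
  have "emeasure lborel (parab \<inter> U) \<le> emeasure lborel U" using U by (intro emeasure_mono) auto
  then have fin': "emeasure lborel (parab \<inter> U) < \<infinity>"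
    using emeasure_bounded_finite[OF fin] by (simp add: le_less_trans)
  have "emeasure lborel (\<Union>n. A n) \<le> emeasure lborel (parab \<inter> U)"
    using UA U by (intro emeasure_mono) auto
  then have "emeasure lborel (\<Union>n. A n) \<noteq> \<infinity>" using fin' by (auto simp: top_unique)
  then have "(\<lambda>n. measure lborel (A n)) \<longlonglongrightarrow> measure lborel (\<Union>n. A n)"
    using A \<open>incseq A\<close> by (intro Lim_measure_incseq) auto
  moreover have "measure lborel (\<Union>n. A n) = measure lborel (parab \<inter> U)"
  proof (rule measure_eq_AE)
    have "{x. tail_form x = 2 * x $ e / b e} \<in> null_sets lborel"
    proof -
      have "{x. tail_form x = 2 * x $ e / b e} \<in> sets borel" by measurable
      then show ?thesis
        using negligible_parab_boundary by (simp add: negligible_iff_null_sets null_sets_completion_iff)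
    qed
    then have "AE x in lborel. x \<notin> {x. tail_form x = 2 * x $ e / b e}" by (rule AE_not_in)
    then show "AE x in lborel. x \<in> (\<Union>n. A n) \<longleftrightarrow> x \<in> parab \<inter> U"
    proof eventually_elim
      case (elim x)
      have "x \<in> (\<Union>n. A n)" if x: "x \<in> parab" "x \<in> U"
      proof -
        \<comment> \<open>The slack d of the strict inequality eventually exceeds the correction
          term, which is of order (n + 1)^(-r).\<close>
        define d where "d = 2 * x $ e / b e - tail_form x"
        have d: "0 < d" using elim x by (auto simp: d_def parab_def)
        have "(\<lambda>n. real (Suc n) powr - r) \<longlonglongrightarrow> 0"
          using r by (intro tendsto_neg_powr filterlim_compose[OF filterlim_real_sequentially filterlim_Suc]) auto
        then have "(\<lambda>n. (x $ e)\<^sup>2 / (b e)\<^sup>2 * real (Suc n) powr - r) \<longlonglongrightarrow> 0"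
          by (rule tendsto_mult_right_zero)
        then have "(\<lambda>n. (x $ e)\<^sup>2 / (real (Suc n) powr r * (b e)\<^sup>2)) \<longlonglongrightarrow> 0"
          by (simp add: powr_minus divide_inverse mult_ac del: of_nat_Suc)
        then have "\<forall>\<^sub>F n in sequentially. (x $ e)\<^sup>2 / (real (Suc n) powr r * (b e)\<^sup>2) < d"
          using d by (rule order_tendstoD)
        then obtain n where "(x $ e)\<^sup>2 / (real (Suc n) powr r * (b e)\<^sup>2) < d"
          using eventually_happens'[OF sequentially_bot] by blast
        then have "x \<in> A n" using x by (auto simp: A_def zoomed_def d_def)
        then show ?thesis by blast
      qed
      then show ?case using UA by blast
    qed
  qed (use A U in auto)
  ultimately have "(\<lambda>n. measure lborel (A n)) \<longlonglongrightarrow> measure lborel (parab \<inter> U)"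
    by (simp only:)
  then show ?thesis unfolding A_def by (rule LIMSEQ_imp_Suc)
qed

end


section \<open>Limit lemmas for real sequences and for random subsets of a finite set\<close>

text \<open>From 1 - q <= exp (-q) <= 1 / (1 + q) <= 1 - q + q^2 and the Lipschitz bound for n-th
  powers on [0, 1], the quantities (1 - q)^n and exp (-n q) differ by at most n q^2 = (n q)^2 / n.
  No logarithm is taken, so q = 1 causes no trouble.\<close>

lemma power_one_minus_tendsto_exp:
  fixes q :: "nat \<Rightarrow> real"
  assumes q: "\<And>n. 0 \<le> q n" "\<And>n. q n \<le> 1" and lim: "(\<lambda>n. real n * q n) \<longlonglongrightarrow> l"
  shows "(\<lambda>n. (1 - q n) ^ n) \<longlonglongrightarrow> exp (- l)"
proof -
  have bound: "\<bar>(1 - q n) ^ n - exp (- (real n * q n))\<bar> \<le> (real n * q n) * (real n * q n) * (1 / real n)" for n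
  proof -
    have lower: "1 - q n \<le> exp (- q n)" using exp_ge_add_one_self[of "- q n"] by simp
    have "exp (- q n) = 1 / exp (q n)" by (simp add: exp_minus inverse_eq_divide)
    also have "\<dots> \<le> 1 / (1 + q n)"
      using exp_ge_add_one_self[of "q n"] q(1)[of n] by (intro divide_left_mono) auto
    also have "\<dots> \<le> 1 - q n + q n * q n"
    proof -
      have "1 \<le> (1 - q n + q n * q n) * (1 + q n)"
        using q(1)[of n] by (simp add: algebra_simps)
      then show ?thesis using q(1)[of n] by (simp add: pos_divide_le_eq)
    qed
    finally have upper: "exp (- q n) \<le> 1 - q n + q n * q n" .
    have "norm ((1 - q n) ^ n - exp (- q n) ^ n) \<le> real n * norm ((1 - q n) - exp (- q n))"
      using q(1)[of n] q(2)[of n] by (intro norm_power_diff) auto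
    also have "\<dots> \<le> real n * (q n * q n)"
      using lower upper by (intro mult_left_mono) auto
    also have "\<dots> = (real n * q n) * (real n * q n) * (1 / real n)" by simp
    finally have "norm ((1 - q n) ^ n - exp (- q n) ^ n) \<le> (real n * q n) * (real n * q n) * (1 / real n)" .
    moreover have "exp (- q n) ^ n = exp (- (real n * q n))"
      unfolding exp_of_nat_mult[symmetric] by (simp only: mult_minus_right)
    ultimately show ?thesis by (simp only: real_norm_def)
  qed
  have "(\<lambda>n. (real n * q n) * (real n * q n) * (1 / real n)) \<longlonglongrightarrow> l * l * 0"
    by (intro tendsto_mult lim lim_1_over_n)
  then have "(\<lambda>n. (real n * q n) * (real n * q n) * (1 / real n)) \<longlonglongrightarrow> 0"
    by (simp only: mult_zero_right)
  then have "(\<lambda>n. (1 - q n) ^ n - exp (- (real n * q n))) \<longlonglongrightarrow> 0"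
    by (rule Lim_null_comparison[rotated])
      (rule always_eventually, rule allI, simp only: real_norm_def bound)
  moreover have "(\<lambda>n. exp (- (real n * q n))) \<longlonglongrightarrow> exp (- l)"
    by (intro tendsto_intros lim)
  ultimately have "(\<lambda>n. ((1 - q n) ^ n - exp (- (real n * q n))) + exp (- (real n * q n)))
      \<longlonglongrightarrow> 0 + exp (- l)"
    by (rule tendsto_add)
  then show ?thesis by simp
qed

text \<open>The bounding sequences and their limits may depend on \<epsilon>, as they do when the
  cells are refined with \<epsilon>. Only these limits are compared with F, and continuity at t
  absorbs the shift.\<close>

lemma tendsto_sandwich_isCont:
  fixes F :: "real \<Rightarrow> real" and f :: "nat \<Rightarrow> real"
  assumes cont: "isCont F t"
    and upper: "\<And>\<epsilon>. 0 < \<epsilon> \<Longrightarrow> \<epsilon> < 1 \<Longrightarrow> \<exists>g l. g \<longlonglongrightarrow> l \<and> (\<forall>\<^sub>F n in sequentially. f n \<le> g n) \<and> l \<le> F (t + \<epsilon>)"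
    and lower: "\<And>\<epsilon>. 0 < \<epsilon> \<Longrightarrow> \<epsilon> < 1 \<Longrightarrow> \<exists>g l. g \<longlonglongrightarrow> l \<and> (\<forall>\<^sub>F n in sequentially. g n \<le> f n) \<and> F (t - \<epsilon>) \<le> l"
  shows "f \<longlonglongrightarrow> F t"
proof (rule tendstoI)
  fix \<eta> :: real assume \<eta>: "0 < \<eta>"
  obtain d where d: "0 < d" "\<And>s. dist s t < d \<Longrightarrow> dist (F s) (F t) < \<eta> / 2"
    using cont half_gt_zero[OF \<eta>] unfolding continuous_at_eps_delta by blast
  define \<epsilon> where "\<epsilon> = min (d / 2) (1 / 2)"
  have \<epsilon>: "0 < \<epsilon>" "\<epsilon> < d" "\<epsilon> < 1" using d(1) by (auto simp: \<epsilon>_def)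
  have F: "F (t + \<epsilon>) < F t + \<eta> / 2" "F t - \<eta> / 2 < F (t - \<epsilon>)"
    using d(2)[of "t + \<epsilon>"] d(2)[of "t - \<epsilon>"] \<epsilon> by (simp_all only: dist_real_def abs_less_iff) linarith+
  obtain g l where g: "g \<longlonglongrightarrow> l" "\<forall>\<^sub>F n in sequentially. f n \<le> g n" "l \<le> F (t + \<epsilon>)"
    using upper[OF \<epsilon>(1,3)] by blast
  obtain g' l' where g': "g' \<longlonglongrightarrow> l'" "\<forall>\<^sub>F n in sequentially. g' n \<le> f n" "F (t - \<epsilon>) \<le> l'"
    using lower[OF \<epsilon>(1,3)] by blast
  have "\<forall>\<^sub>F n in sequentially. g n < l + \<eta> / 2" "\<forall>\<^sub>F n in sequentially. l' - \<eta> / 2 < g' n"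
    using order_tendstoD(2)[OF g(1)] order_tendstoD(1)[OF g'(1)] \<eta> by simp_all
  with g(2) g'(2) show "\<forall>\<^sub>F n in sequentially. dist (f n) (F t) < \<eta>"
  proof eventually_elim
    case (elim n)
    then show ?case using F g(3) g'(3) unfolding dist_real_def abs_less_iff by linarith
  qed
qed

lemma sets_avoid:
  assumes finI: "finite I"
    and meas: "\<And>i. i \<in> I \<Longrightarrow> {\<omega> \<in> space M. i \<in> S \<omega>} \<in> sets M"
    and WV: "W \<subseteq> I" "V \<subseteq> I"
  shows "{\<omega> \<in> space M. W \<subseteq> S \<omega> \<and> S \<omega> \<inter> V = {}} \<in> sets M"
proof -
  have pred: "Measurable.pred M (\<lambda>\<omega>. i \<in> S \<omega>)" if "i \<in> I" for i
    using meas[OF that] by (simp add: pred_def)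
  have fin: "finite W" "finite V" using WV finI by (auto dest: finite_subset)
  have "Measurable.pred M (\<lambda>\<omega>. \<forall>i\<in>W. i \<in> S \<omega>)"
    using WV(1) by (intro pred_intros_finite(3)[OF fin(1)] pred) auto
  moreover have "Measurable.pred M (\<lambda>\<omega>. \<forall>i\<in>V. \<not> i \<in> S \<omega>)"
    using WV(2) by (intro pred_intros_finite(3)[OF fin(2)] pred_intros_logic pred) auto
  ultimately have "Measurable.pred M (\<lambda>\<omega>. (\<forall>i\<in>W. i \<in> S \<omega>) \<and> (\<forall>i\<in>V. \<not> i \<in> S \<omega>))"
    by (rule pred_intros_logic(3))
  then have "{\<omega> \<in> space M. (\<forall>i\<in>W. i \<in> S \<omega>) \<and> (\<forall>i\<in>V. \<not> i \<in> S \<omega>)} \<in> sets M"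
    by (simp add: pred_def)
  moreover have "W \<subseteq> S \<omega> \<and> S \<omega> \<inter> V = {} \<longleftrightarrow> (\<forall>i\<in>W. i \<in> S \<omega>) \<and> (\<forall>i\<in>V. \<not> i \<in> S \<omega>)" for \<omega>
    by auto
  ultimately show ?thesis by (simp only:)
qed

text \<open>One step of inclusion-exclusion: the requirement that x be hit is traded for a
  difference of two events, in which x is unconstrained and avoided respectively.\<close>

lemma measure_avoid_diff:
  assumes "finite_measure M" and finI: "finite I"
    and meas: "\<And>i. i \<in> I \<Longrightarrow> {\<omega> \<in> space M. i \<in> S \<omega>} \<in> sets M"
    and sub: "W \<subseteq> I" "V \<subseteq> I" "x \<in> I"
  shows "measure M {\<omega> \<in> space M. insert x W \<subseteq> S \<omega> \<and> S \<omega> \<inter> V = {}}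
       = measure M {\<omega> \<in> space M. W \<subseteq> S \<omega> \<and> S \<omega> \<inter> V = {}}
       - measure M {\<omega> \<in> space M. W \<subseteq> S \<omega> \<and> S \<omega> \<inter> insert x V = {}}"
proof -
  interpret finite_measure M by fact
  define A where "A = {\<omega> \<in> space M. W \<subseteq> S \<omega> \<and> S \<omega> \<inter> V = {}}"
  define B where "B = {\<omega> \<in> space M. W \<subseteq> S \<omega> \<and> S \<omega> \<inter> insert x V = {}}"
  have "A \<in> sets M" "B \<in> sets M"
    unfolding A_def B_def using sub by (intro sets_avoid[OF finI meas]; simp)+
  moreover have "B \<subseteq> A" unfolding A_def B_def by auto
  moreover have "{\<omega> \<in> space M. insert x W \<subseteq> S \<omega> \<and> S \<omega> \<inter> V = {}} = A - B"
    unfolding A_def B_def by auto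
  ultimately show ?thesis
    using finite_measure_Diff[of A B] by (simp only: A_def[symmetric] B_def[symmetric])
qed

text \<open>Splits the event by the exact value W of the random set. That value is encoded as
  hitting all of W and avoiding \<open>I - W\<close>, the form to which
  \<open>measure_avoid_diff\<close> applies.\<close>

lemma measure_pattern_sum:
  assumes "finite_measure M" and finI: "finite I"
    and meas: "\<And>i. i \<in> I \<Longrightarrow> {\<omega> \<in> space M. i \<in> S \<omega>} \<in> sets M"
    and sub: "\<And>\<omega>. \<omega> \<in> space M \<Longrightarrow> S \<omega> \<subseteq> I"
  shows "{\<omega> \<in> space M. S \<omega> \<in> \<A>} \<in> sets M"
    and "measure M {\<omega> \<in> space M. S \<omega> \<in> \<A>}
       = (\<Sum>W \<in> \<A> \<inter> Pow I. measure M {\<omega> \<in> space M. W \<subseteq> S \<omega> \<and> S \<omega> \<inter> (I - W) = {}})"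
proof -
  interpret finite_measure M by fact
  define A where "A W = {\<omega> \<in> space M. W \<subseteq> S \<omega> \<and> S \<omega> \<inter> (I - W) = {}}" for W
  have A: "A W = {\<omega> \<in> space M. S \<omega> = W}" if "W \<subseteq> I" for W
  proof -
    have "W \<subseteq> S \<omega> \<and> S \<omega> \<inter> (I - W) = {} \<longleftrightarrow> S \<omega> = W" if "\<omega> \<in> space M" for \<omega>
      using sub[OF that] \<open>W \<subseteq> I\<close> by blast
    then show ?thesis unfolding A_def by blast
  qed
  have A_sets: "A W \<in> sets M" if "W \<in> \<A> \<inter> Pow I" for W
    unfolding A_def using that by (intro sets_avoid[OF finI meas]) auto
  have eq: "{\<omega> \<in> space M. S \<omega> \<in> \<A>} = (\<Union>W\<in>\<A> \<inter> Pow I. A W)"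
  proof -
    have "(\<Union>W\<in>\<A> \<inter> Pow I. A W) = (\<Union>W\<in>\<A> \<inter> Pow I. {\<omega> \<in> space M. S \<omega> = W})"
      by (rule SUP_cong) (simp_all add: A)
    also have "\<dots> = {\<omega> \<in> space M. S \<omega> \<in> \<A> \<inter> Pow I}" by auto
    also have "\<dots> = {\<omega> \<in> space M. S \<omega> \<in> \<A>}"
      by (rule Collect_cong) (metis IntE IntI PowI sub)
    finally show ?thesis ..
  qed
  have fin: "finite (\<A> \<inter> Pow I)" using finI by simp
  show "{\<omega> \<in> space M. S \<omega> \<in> \<A>} \<in> sets M"
    unfolding eq using A_sets fin by (intro sets.finite_UN) auto
  have "disjoint_family_on A (\<A> \<inter> Pow I)"
    unfolding disjoint_family_on_def
  proof (intro ballI impI)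
    fix W V assume "W \<in> \<A> \<inter> Pow I" "V \<in> \<A> \<inter> Pow I" "W \<noteq> V"
    then show "A W \<inter> A V = {}" using A[of W] A[of V] by simp blast
  qed
  then have "measure M (\<Union>W\<in>\<A> \<inter> Pow I. A W) = (\<Sum>W\<in>\<A> \<inter> Pow I. measure M (A W))"
    using A_sets fin by (intro finite_measure_finite_Union) auto
  then show "measure M {\<omega> \<in> space M. S \<omega> \<in> \<A>}
       = (\<Sum>W \<in> \<A> \<inter> Pow I. measure M {\<omega> \<in> space M. W \<subseteq> S \<omega> \<and> S \<omega> \<inter> (I - W) = {}})"
    unfolding eq A_def .
qed

text \<open>The avoidance probabilities of a random subset of a finite set determine its distribution
  by inclusion-exclusion, hence their convergence implies convergence in distribution.\<close>

lemma random_subset_tendsto: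
  assumes "finite_measure M" "finite_measure M'" and finI: "finite I"
    and meas: "\<And>n i. i \<in> I \<Longrightarrow> {\<omega> \<in> space M. i \<in> S n \<omega>} \<in> sets M"
    and meas': "\<And>i. i \<in> I \<Longrightarrow> {\<omega> \<in> space M'. i \<in> S' \<omega>} \<in> sets M'"
    and sub: "\<And>n \<omega>. \<omega> \<in> space M \<Longrightarrow> S n \<omega> \<subseteq> I"
    and sub': "\<And>\<omega>. \<omega> \<in> space M' \<Longrightarrow> S' \<omega> \<subseteq> I"
    and avoid: "\<And>V. V \<subseteq> I \<Longrightarrow> (\<lambda>n. measure M {\<omega> \<in> space M. S n \<omega> \<inter> V = {}})
        \<longlonglongrightarrow> measure M' {\<omega> \<in> space M'. S' \<omega> \<inter> V = {}}"
  shows "(\<lambda>n. measure M {\<omega> \<in> space M. S n \<omega> \<in> \<A>}) \<longlonglongrightarrow> measure M' {\<omega> \<in> space M'. S' \<omega> \<in> \<A>}"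
proof -
  have pattern: "(\<lambda>n. measure M {\<omega> \<in> space M. W \<subseteq> S n \<omega> \<and> S n \<omega> \<inter> V = {}})
        \<longlonglongrightarrow> measure M' {\<omega> \<in> space M'. W \<subseteq> S' \<omega> \<and> S' \<omega> \<inter> V = {}}"
    if "W \<subseteq> I" "V \<subseteq> I" for W V
  proof -
    have "finite W" using that finI by (auto dest: finite_subset)
    then show ?thesis using that
    \<comment> \<open>The induction removes the elements that must be hit one at a time;
      \<open>V\<close> is arbitrary because each step also moves an element into the avoided
      set.\<close>
    proof (induction W arbitrary: V)
      case empty
      then show ?case using avoid by simp
    next
      case (insert x W)
      then have *: "W \<subseteq> I" "V \<subseteq> I" "x \<in> I" "insert x V \<subseteq> I" by auto
      have "measure M {\<omega> \<in> space M. insert x W \<subseteq> S n \<omega> \<and> S n \<omega> \<inter> V = {}}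
         = measure M {\<omega> \<in> space M. W \<subseteq> S n \<omega> \<and> S n \<omega> \<inter> V = {}}
         - measure M {\<omega> \<in> space M. W \<subseteq> S n \<omega> \<and> S n \<omega> \<inter> insert x V = {}}" for n
        by (rule measure_avoid_diff[OF assms(1) finI meas *(1-3)])
      moreover have "measure M' {\<omega> \<in> space M'. insert x W \<subseteq> S' \<omega> \<and> S' \<omega> \<inter> V = {}}
         = measure M' {\<omega> \<in> space M'. W \<subseteq> S' \<omega> \<and> S' \<omega> \<inter> V = {}}
         - measure M' {\<omega> \<in> space M'. W \<subseteq> S' \<omega> \<and> S' \<omega> \<inter> insert x V = {}}"
        by (rule measure_avoid_diff[OF assms(2) finI meas' *(1-3)])
      ultimately show ?case
        by (simp only:) (intro tendsto_diff insert.IH *)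
    qed
  qed
  have "measure M {\<omega> \<in> space M. S n \<omega> \<in> \<A>}
     = (\<Sum>W \<in> \<A> \<inter> Pow I. measure M {\<omega> \<in> space M. W \<subseteq> S n \<omega> \<and> S n \<omega> \<inter> (I - W) = {}})" for n
    by (rule measure_pattern_sum(2)[OF assms(1) finI meas sub])
  moreover have "measure M' {\<omega> \<in> space M'. S' \<omega> \<in> \<A>}
     = (\<Sum>W \<in> \<A> \<inter> Pow I. measure M' {\<omega> \<in> space M'. W \<subseteq> S' \<omega> \<and> S' \<omega> \<inter> (I - W) = {}})"
    by (rule measure_pattern_sum(2)[OF assms(2) finI meas' sub'])
  ultimately show ?thesis
    by (simp only:) (intro tendsto_sum pattern, auto)
qed

section \<open>Probability that the sample misses a set\<close>

context prob_space
begin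

lemma prob_avoid_indep:
  assumes indep: "indep_vars (\<lambda>_. borel) Z {1::nat..}"
    and distr: "\<And>i. 1 \<le> i \<Longrightarrow> distr M borel (Z i) = D"
    and B: "B \<in> sets borel"
  shows "prob {\<omega> \<in> space M. \<forall>i\<in>{1..k}. Z i \<omega> \<notin> B} = (1 - measure D B) ^ k"
\<comment> \<open>The empty sample is treated apart since \<open>indep_varsD\<close> concerns
  nonempty index sets.\<close>
proof (cases "k = 0")
  case True
  then show ?thesis by (simp add: prob_space)
next
  case False
  have meas: "Z i \<in> borel_measurable M" if "1 \<le> i" for i
    using indep that by (auto simp: indep_vars_def)
  have D1: "distr M borel (Z 1) = D" by (rule distr) simp
  then interpret D: prob_space D using meas[of 1] prob_space_distr by auto
  have setsD: "sets D = sets borel" using D1 by (metis sets_distr)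
  have "{\<omega> \<in> space M. \<forall>i\<in>{1..k}. Z i \<omega> \<notin> B} = (\<Inter>i\<in>{1..k}. Z i -` (- B) \<inter> space M)"
    using False by auto
  also have "prob \<dots> = (\<Prod>i\<in>{1..k}. prob (Z i -` (- B) \<inter> space M))"
    using False B by (intro indep_varsD[OF indep]) auto
  also have "\<dots> = (\<Prod>i\<in>{1..k}. 1 - measure D B)"
  proof (rule prod.cong)
    fix i assume "i \<in> {1..k}"
    then have i: "1 \<le> i" by simp
    have "prob (Z i -` (- B) \<inter> space M) = measure (distr M borel (Z i)) (- B)"
      using B meas[OF i] by (intro measure_distr[symmetric]) auto
    also have "\<dots> = measure D (space D - B)"
      using distr[OF i] setsD sets_eq_imp_space_eq[OF setsD] by (simp add: Compl_eq_Diff_UNIV)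
    also have "\<dots> = 1 - measure D B" using B setsD by (intro D.prob_compl) auto
    finally show "prob (Z i -` (- B) \<inter> space M) = 1 - measure D B" .
  qed simp
  finally show ?thesis by simp
qed

text \<open>Splitting by the number k of points gives the terms exp (-r) (r (1 - q))^k / k! with q
  the mass of B, and the exponential series sums them to exp (-r q). This is the thinning property
  of a Poisson sample.\<close>

lemma prob_avoid_poissonized:
  assumes indep: "indep_vars (\<lambda>_. borel) Z {1::nat..}"
    and distr: "\<And>i. 1 \<le> i \<Longrightarrow> distr M borel (Z i) = D"
    and r: "0 < r" and N: "distr M (count_space UNIV) N = measure_pmf (poisson_pmf r)"
    and NZ: "indep_rv M (count_space UNIV) N (PiM {1..} (\<lambda>_. borel)) (\<lambda>\<omega>. \<lambda>i\<in>{1..}. Z i \<omega>)"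
    and B: "B \<in> sets borel"
  shows "prob {\<omega> \<in> space M. \<forall>i\<in>{1..N \<omega>}. Z i \<omega> \<notin> B} = exp (- (r * measure D B))"
proof -
  have meas [measurable]: "Z i \<in> borel_measurable M" if "1 \<le> i" for i
    using indep that by (auto simp: indep_vars_def)
  have N_meas [measurable]: "N \<in> measurable M (count_space UNIV)"
    using NZ by (simp add: indep_rv_def)
  define A where "A k = {\<omega> \<in> space M. \<forall>i\<in>{1..k}. Z i \<omega> \<notin> B}" for k
  define C where "C k = {\<omega> \<in> space M. N \<omega> = k}" for k
  have A_sets: "A k \<in> events" for k
  proof -
    have "A k = space M \<inter> (\<Inter>i\<in>{1..k}. {\<omega> \<in> space M. Z i \<omega> \<notin> B})" by (auto simp: A_def)
    moreover have "{\<omega> \<in> space M. Z i \<omega> \<notin> B} \<in> events" if "i \<in> {1..k}" for i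
    proof -
      have [measurable]: "Z i \<in> borel_measurable M" using that meas by simp
      show ?thesis using B by measurable
    qed
    ultimately show ?thesis by (cases "k = 0") auto
  qed
  have C_sets: "C k \<in> events" for k unfolding C_def by measurable
  \<comment> \<open>Independence is assumed between \<open>N\<close> and the whole sequence, so the
    event \<open>A k\<close> has to be exhibited as the preimage of a cylinder set \<open>F\<close>
    in the product space.\<close>
  have split: "prob (C k \<inter> A k) = prob (C k) * prob (A k)" for k
  proof -
    define F where "F = {f \<in> space (PiM {1..} (\<lambda>_. borel)). \<forall>i\<in>{1..k}. f i \<notin> B}"
    have "F \<in> sets (PiM {1::nat..} (\<lambda>_. borel))"
    proof -
      have "F = space (PiM {1..} (\<lambda>_. borel)) \<inter>
         (\<Inter>i\<in>{1..k}. {f \<in> space (PiM {1::nat..} (\<lambda>_. borel)). f i \<notin> B})" by (auto simp: F_def)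
      moreover have "{f \<in> space (PiM {1::nat..} (\<lambda>_. borel)). f i \<notin> B} \<in> sets (PiM {1..} (\<lambda>_. borel))"
        if "i \<in> {1..k}" for i
      proof -
        have [measurable]: "(\<lambda>f. f i) \<in> measurable (PiM {1::nat..} (\<lambda>_. borel)) borel"
          using that by (intro measurable_component_singleton) auto
        show ?thesis using B by measurable
      qed
      ultimately show ?thesis by (cases "k = 0") auto
    qed
    moreover have "A k = (\<lambda>\<omega>. \<lambda>i\<in>{1..}. Z i \<omega>) -` F \<inter> space M"
      by (auto simp: F_def A_def space_PiM)
    ultimately have A_in: "A k \<in> {(\<lambda>\<omega>. \<lambda>i\<in>{1..}. Z i \<omega>) -` B \<inter> space M | B. B \<in> sets (PiM {1..} (\<lambda>_. borel))}"
      by blast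
    have C_in: "C k \<in> {N -` A \<inter> space M | A. A \<in> sets (count_space UNIV)}"
    proof -
      have "C k = N -` {k} \<inter> space M" by (auto simp: C_def)
      then show ?thesis by auto
    qed
    have "indep_set {N -` A \<inter> space M | A. A \<in> sets (count_space UNIV)}
        {(\<lambda>\<omega>. \<lambda>i\<in>{1..}. Z i \<omega>) -` B \<inter> space M | B. B \<in> sets (PiM {1..} (\<lambda>_. borel))}"
      using NZ unfolding indep_rv_def by (elim conjE)
    then show ?thesis using C_in A_in by (rule indep_setD)
  qed
  have "prob (C k) = r ^ k / fact k * exp (- r)" for k
  proof -
    have "C k = N -` {k} \<inter> space M" by (auto simp: C_def)
    then have "prob (C k) = measure (distr M (count_space UNIV) N) {k}"
      by (simp add: measure_distr)
    then show ?thesis using r by (simp add: N measure_pmf_single)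
  qed
  moreover have "prob (A k) = (1 - measure D B) ^ k" for k
    unfolding A_def by (rule prob_avoid_indep[OF indep distr B])
  ultimately have CA: "prob (C k \<inter> A k) = exp (- r) * ((r * (1 - measure D B)) ^ k / fact k)" for k
    by (simp add: split power_mult_distrib)
  have "{\<omega> \<in> space M. \<forall>i\<in>{1..N \<omega>}. Z i \<omega> \<notin> B} = (\<Union>k. C k \<inter> A k)"
    by (auto simp: C_def A_def)
  moreover have "(\<lambda>k. prob (C k \<inter> A k)) sums prob (\<Union>k. C k \<inter> A k)"
    using A_sets C_sets by (intro finite_measure_UNION) (auto simp: disjoint_family_on_def C_def)
  moreover have "(\<lambda>k. prob (C k \<inter> A k)) sums (exp (- r) * exp (r * (1 - measure D B)))"
    unfolding CA using exp_converges[of "r * (1 - measure D B)"]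
    by (intro sums_mult) (simp add: divide_inverse mult.commute scaleR_conv_of_real)
  ultimately have "prob {\<omega> \<in> space M. \<forall>i\<in>{1..N \<omega>}. Z i \<omega> \<notin> B}
      = exp (- r) * exp (r * (1 - measure D B))" by (metis sums_unique2)
  also have "\<dots> = exp (- (r * measure D B))"
    unfolding exp_add[symmetric] by (simp add: algebra_simps)
  finally show ?thesis .
qed

end


section \<open>The maximal distance and the slab that carries nearly extremal pairs\<close>

lemma max_dist_ge_iff:
  assumes "1 \<le> k"
  shows "r \<le> max_dist z k \<longleftrightarrow> (\<exists>i\<in>{1..k}. \<exists>j\<in>{1..k}. r \<le> norm (z i - z j))"
proof -
  have "(\<lambda>(i, j). norm (z i - z j)) ` ({1..k} \<times> {1..k}) \<noteq> {}" using assms by auto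
  then show ?thesis using assms unfolding max_dist_def by (subst if_not_P) (auto simp: Max_ge_iff)
qed

lemma max_dist_measurable:
  fixes Z :: "nat \<Rightarrow> 'w \<Rightarrow> 'v :: {second_countable_topology, real_normed_vector}"
  assumes "\<And>i. 1 \<le> i \<Longrightarrow> Z i \<in> borel_measurable M"
    and \<nu>: "\<nu> \<in> measurable M (count_space UNIV)"
  shows "(\<lambda>\<omega>. max_dist (\<lambda>i. Z i \<omega>) (\<nu> \<omega>)) \<in> borel_measurable M"
proof (rule measurable_compose_countable[OF _ \<nu>])
  fix k
  show "(\<lambda>\<omega>. max_dist (\<lambda>i. Z i \<omega>) k :: real) \<in> borel_measurable M"
  proof (cases "k = 0")
    case False
    have "(\<lambda>\<omega>. Max ((\<lambda>p. norm (Z (fst p) \<omega> - Z (snd p) \<omega>)) ` ({1..k} \<times> {1..k}))) \<in> borel_measurable M"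
      by (rule borel_measurable_Max) (use assms(1) in \<open>auto intro!: borel_measurable_norm borel_measurable_diff\<close>)
    then show ?thesis using False by (simp add: max_dist_def case_prod_beta')
  qed (simp add: max_dist_def)
qed

text \<open>The upper end of the index range is random, so the event is assembled from the countably
  many possible values of \<open>\<nu>\<close>.\<close>

lemma sets_ex_random_index:
  fixes \<nu> :: "'w \<Rightarrow> nat"
  assumes P: "\<And>i. 1 \<le> i \<Longrightarrow> {\<omega> \<in> space M. P i \<omega>} \<in> sets M"
    and \<nu>: "\<nu> \<in> measurable M (count_space UNIV)"
  shows "{\<omega> \<in> space M. \<exists>i\<in>{1..\<nu> \<omega>}. P i \<omega>} \<in> sets M"
proof -
  have "Measurable.pred M (\<lambda>\<omega>. (\<lambda>k \<omega>. \<exists>i\<in>{1..k}. P i \<omega>) (\<nu> \<omega>) \<omega>)"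
  proof (rule measurable_compose_countable[OF _ \<nu>])
    fix k
    show "Measurable.pred M (\<lambda>\<omega>. \<exists>i\<in>{1..k}. P i \<omega>)"
      by (rule pred_intros_finite(4)) (use P in \<open>auto simp: pred_def\<close>)
  qed
  then show ?thesis by (simp add: pred_def)
qed

context dominant_axis
begin

definition slab :: "real \<Rightarrow> (real ^ 'n) set" where
  "slab T = {x \<in> parab. x $ e \<le> T}"

text \<open>Boundedness is the point: in \<open>parab\<close> a bound on the axis coordinate bounds
  the tail form and hence, by \<open>tail_sq_le\<close>, the norm.\<close>

lemma slab_compact: "compact (slab T)"
proof -
  have "continuous_on UNIV tail_form" "continuous_on UNIV (\<lambda>x::real^'n. 2 * x $ e / b e)"
    unfolding tail_form_def by (auto intro!: continuous_intros)
  then have "closed {x. tail_form x \<le> 2 * x $ e / b e}" by (rule closed_Collect_le)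
  moreover have "closed {x::real^'n. x $ e \<le> T}"
    by (rule closed_Collect_le) (auto intro!: continuous_intros)
  ultimately have "closed ({x. tail_form x \<le> 2 * x $ e / b e} \<inter> {x. x $ e \<le> T})" by (rule closed_Int)
  moreover have "slab T = {x. tail_form x \<le> 2 * x $ e / b e} \<inter> {x. x $ e \<le> T}"
    by (auto simp: slab_def parab_def)
  ultimately have "closed (slab T)" by (simp only:)
  moreover have "bounded (slab T)"
  proof (rule boundedI)
    fix x assume "x \<in> slab T"
    then have x: "x \<in> parab" "x $ e \<le> T" by (auto simp: slab_def)
    note nonneg = parab_axis_nonneg[OF x(1)]
    have "tail_form x \<le> 2 * x $ e / b e" using x(1) by (simp add: parab_def)
    also have "\<dots> \<le> 2 * T / b e" using x(2) axes_pos[of e] by (simp add: divide_right_mono)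
    finally have "\<beta>\<^sup>2 * tail_form x \<le> \<beta>\<^sup>2 * (2 * T / b e)" by (rule mult_left_mono) simp
    moreover have "(x $ e)\<^sup>2 \<le> T\<^sup>2" using nonneg x(2) by (rule power_mono[rotated])
    ultimately have "(norm x)\<^sup>2 \<le> T\<^sup>2 + \<beta>\<^sup>2 * (2 * T / b e)"
      unfolding norm_sq_split using tail_sq_le[of x] by linarith
    then show "norm x \<le> sqrt (T\<^sup>2 + \<beta>\<^sup>2 * (2 * T / b e))" by (rule real_le_rsqrt)
  qed
  ultimately show ?thesis by (simp add: compact_eq_bounded_closed)
qed

lemma slab_borel [measurable]: "slab T \<in> sets borel"
  using slab_compact by (rule borel_compact)

lemma gap_uniformly_continuous:
  assumes "0 < \<epsilon>"
  obtains \<delta> where "0 < \<delta>"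
    "\<And>u v u' v'. \<lbrakk>u \<in> slab T; v \<in> slab T; u' \<in> slab T; v' \<in> slab T; dist u u' < \<delta>; dist v v' < \<delta>\<rbrakk>
      \<Longrightarrow> \<bar>gap u v - gap u' v'\<bar> < \<epsilon>"
proof -
  have "continuous_on (slab T \<times> slab T) (\<lambda>p. gap (fst p) (snd p))"
    unfolding gap_def by (auto intro!: continuous_intros)
  then have "uniformly_continuous_on (slab T \<times> slab T) (\<lambda>p. gap (fst p) (snd p))"
    by (intro compact_uniformly_continuous compact_Times slab_compact)
  then obtain d where d: "0 < d" "\<And>p q. \<lbrakk>p \<in> slab T \<times> slab T; q \<in> slab T \<times> slab T; dist q p < d\<rbrakk>
      \<Longrightarrow> dist (gap (fst q) (snd q)) (gap (fst p) (snd p)) < \<epsilon>"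
    using assms unfolding uniformly_continuous_on_def by metis
  show ?thesis
  proof (rule that[of "d / 2"])
    fix u v u' v' assume *: "u \<in> slab T" "v \<in> slab T" "u' \<in> slab T" "v' \<in> slab T"
      "dist u u' < d / 2" "dist v v' < d / 2"
    have "dist (u, v) (u', v') \<le> dist u u' + dist v v'"
      unfolding dist_Pair_Pair by (rule sqrt_sum_squares_le_sum) auto
    then have "dist (u, v) (u', v') < d" using *(5,6) by linarith
    then have "dist (gap u v) (gap u' v') < \<epsilon>"
      using d(2)[of "(u', v')" "(u, v)"] *(1-4) by simp
    then show "\<bar>gap u v - gap u' v'\<bar> < \<epsilon>" by (simp only: dist_real_def)
  qed (use d(1) in simp)
qed

text \<open>Distance is symmetric, so a far pair can be renamed to assign the point with the smaller
  axis coordinate to the vertex blown up by \<open>zoom 1\<close>. Then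
  \<open>zoom_axis_sum_le\<close> bounds the sum of the two axis coordinates, and since both are
  nonnegative each point lies in \<open>slab T\<close>.\<close>

lemma max_dist_small_deficitD:
  assumes c: "0 < c" and z: "\<And>i. i \<in> {1..k} \<Longrightarrow> z i \<in> solid"
    and deficit: "c * (2 * b e - max_dist z k) \<le> r" and rc: "r / c < 2 * b e"
    and T: "2 * r / eccentricity \<le> T"
  obtains i j where "i \<in> {1..k}" "j \<in> {1..k}" "zoom 1 c (z i) \<in> slab T" "zoom (-1) c (z j) \<in> slab T"
    "gap (zoom 1 c (z i)) (zoom (-1) c (z j)) \<le> r + (2 * r / eccentricity)\<^sup>2 / (4 * b e * c)"
proof -
  have far: "2 * b e - r / c \<le> max_dist z k"
    using deficit c by (simp add: field_simps)
  \<comment> \<open>Without points \<open>max_dist\<close> is 0 by convention, which the strict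
    inequality \<open>rc\<close> excludes.\<close>
  have "k \<noteq> 0"
  proof
    assume "k = 0"
    then have "max_dist z k = 0" by (simp add: max_dist_def)
    then show False using far rc by simp
  qed
  then obtain i' j' where ij: "i' \<in> {1..k}" "j' \<in> {1..k}" "2 * b e - r / c \<le> norm (z i' - z j')"
    using far max_dist_ge_iff[of k "2 * b e - r / c" z] by auto
  obtain i j where i: "i \<in> {1..k}" and j: "j \<in> {1..k}"
    and far': "2 * b e - r / c \<le> norm (z i - z j)" and order: "z i $ e \<le> z j $ e"
  proof (cases "z i' $ e \<le> z j' $ e")
    case True
    then show ?thesis using that ij by blast
  next
    case False
    then show ?thesis using that[of j' i'] ij by (simp add: norm_minus_commute)
  qed
  note pair = c z[OF i] z[OF j] order far' less_imp_le[OF rc]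
  have parab: "zoom 1 c (z i) \<in> parab" "zoom (-1) c (z j) \<in> parab"
    using zoomed_subset_parab[OF c] zoom_in_zoomed_iff[OF c, of 1 "z i"]
      zoom_in_zoomed_iff[OF c, of "-1" "z j"] z[OF i] z[OF j] by auto
  have "zoom 1 c (z i) $ e + zoom (-1) c (z j) $ e \<le> T"
    using zoom_axis_sum_le[OF pair] T by linarith
  then have "zoom 1 c (z i) \<in> slab T" "zoom (-1) c (z j) \<in> slab T"
    using parab parab_axis_nonneg[OF parab(1)] parab_axis_nonneg[OF parab(2)] by (auto simp: slab_def)
  then show ?thesis using that i j far_pair_gap_le[OF pair] by blast
qed

lemma max_dist_small_deficitI:
  assumes c: "0 < c" and ij: "i \<in> {1..k}" "j \<in> {1..k}"
    and gap: "gap (zoom 1 c (z i)) (zoom (-1) c (z j)) \<le> r - r\<^sup>2 / (4 * b e * c)"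
  shows "c * (2 * b e - max_dist z k) \<le> r"
proof -
  have "1 \<le> k" using ij by simp
  then have "2 * b e - r / c \<le> max_dist z k"
    unfolding max_dist_ge_iff[OF \<open>1 \<le> k\<close>] using far_pair_if_gap_le[OF c gap] ij by blast
  then show ?thesis using c by (simp add: field_simps)
qed

section \<open>The scaling rate and the expected number of hits\<close>

text \<open>The exponent makes \<open>rate n\<close> to the power (d + 1) / 2 equal to n, the volume
  factor in \<open>emeasure_solid_zoom_vimage\<close>.\<close>

definition rate :: "nat \<Rightarrow> real" where
  "rate n = real n powr (2 / (real CARD('n) + 1))"

lemma rate_at_top: "filterlim rate at_top sequentially"
  unfolding filterlim_at_top_gt[where c = 0]
proof (intro allI impI)
  fix B :: real assume B: "0 < B"
  define s where "s = 2 / (real CARD('n) + 1)"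
  have s: "0 < s" by (simp add: s_def)
  have "\<forall>\<^sub>F n in sequentially. B powr (1 / s) \<le> real n"
    using filterlim_real_sequentially by (simp add: filterlim_at_top)
  then show "\<forall>\<^sub>F n in sequentially. B \<le> rate n"
  proof eventually_elim
    case (elim n)
    have "B = (B powr (1 / s)) powr s" using B s by (simp add: powr_powr)
    also have "\<dots> \<le> real n powr s" using elim s by (intro powr_mono2) auto
    finally show ?case by (simp add: rate_def s_def)
  qed
qed

text \<open>The constant p of the theorem, before its closed form is known.\<close>

definition density_const :: real where
  "density_const = 1 / measure lborel solid"

lemma solid_measure: "0 < measure lborel solid" "emeasure lborel solid = ennreal (measure lborel solid)"
proof -
  define v where "v = unit_ball_vol (real CARD('n)) * (\<Prod>i\<in>UNIV. b i)"
  have "0 < v" unfolding v_def using axes_pos by (intro mult_pos_pos prod_pos) auto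
  moreover have "emeasure lborel solid = ennreal v" by (simp add: emeasure_solid v_def)
  moreover from calculation have "measure lborel solid = v" by (simp add: measure_def)
  ultimately show "0 < measure lborel solid" "emeasure lborel solid = ennreal (measure lborel solid)"
    by simp_all
qed

lemma measure_uniform_solid:
  assumes "B \<in> sets borel"
  shows "measure (uniform_measure lborel solid) B = density_const * measure lborel (solid \<inter> B)"
proof -
  have "measure (uniform_measure lborel solid) B = measure lborel (solid \<inter> B) / measure lborel solid"
    using solid_measure assms by (intro measure_uniform_measure) auto
  then show ?thesis by (simp add: density_const_def)
qed

text \<open>Under the two zooms with factor c, the axis coordinates of a single point add up to 2 c
  b_e, so they cannot both stay below a common bound T of \<open>U\<close> and \<open>V\<close> once
  c > T / b_e. The events of being seen in \<open>U\<close> near one vertex and in \<open>V\<close>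
  near the other are then disjoint and their probabilities add, each converging after multiplication
  by n through \<open>measure_zoomed_tendsto\<close>.\<close>

lemma hitting_rate_tendsto:
  assumes U: "U \<in> sets borel" "bounded U" and V: "V \<in> sets borel" "bounded V"
  shows "(\<lambda>n. real n * measure (uniform_measure lborel solid) (zoom 1 (rate n) -` U \<union> zoom (-1) (rate n) -` V))
    \<longlonglongrightarrow> density_const * (measure lborel (parab \<inter> U) + measure lborel (parab \<inter> V))"
proof -
  define m where "m n A = measure lborel (zoomed (rate n) \<inter> A)" for n A
  obtain T where T: "\<And>x. x \<in> U \<union> V \<Longrightarrow> norm x \<le> T"
    using U(2) V(2) bounded_Un[of U V] unfolding bounded_iff by auto
  have vim: "zoom \<sigma> c -` A \<in> sets borel" if "A \<in> sets borel" for \<sigma> c A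
    using measurable_sets[OF zoom_measurable that] by simp
  have m_eq: "measure lborel (solid \<inter> zoom \<sigma> (rate n) -` A) = m n A / real n"
    if "1 \<le> n" "\<sigma>\<^sup>2 = 1" "A \<in> sets borel" for \<sigma> n A
  proof -
    have "rate n powr (- (real CARD('n) + 1) / 2) = real n powr (-1)"
    proof -
      have "2 / (real CARD('n) + 1) * (- (real CARD('n) + 1) / 2) = -1"
        by (simp add: field_simps)
      then show ?thesis unfolding rate_def powr_powr by (simp only:)
    qed
    also have "\<dots> = 1 / real n" using that by (simp add: powr_minus inverse_eq_divide)
    finally have "emeasure lborel (solid \<inter> zoom \<sigma> (rate n) -` A)
        = ennreal (1 / real n) * emeasure lborel (zoomed (rate n) \<inter> A)"
      using emeasure_solid_zoom_vimage[of "rate n" \<sigma> A] that by (simp add: rate_def)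
    then show ?thesis by (simp add: measure_def m_def enn2real_mult)
  qed
  have "\<forall>\<^sub>F n in sequentially. T / b e < rate n"
    using rate_at_top by (simp add: filterlim_at_top_dense)
  then have "\<forall>\<^sub>F n in sequentially.
      density_const * (m n U + m n V)
      = real n * measure (uniform_measure lborel solid) (zoom 1 (rate n) -` U \<union> zoom (-1) (rate n) -` V)"
    using eventually_ge_at_top[of 1]
  proof eventually_elim
    case (elim n)
    have n: "0 < rate n" using elim(2) by (simp add: rate_def)
    have "zoom 1 (rate n) -` U \<inter> zoom (-1) (rate n) -` V = {}"
    proof (rule ccontr)
      assume "\<not> ?thesis"
      then obtain z where "zoom 1 (rate n) z \<in> U" "zoom (-1) (rate n) z \<in> V" by auto
      then have "norm (zoom 1 (rate n) z) \<le> T" "norm (zoom (-1) (rate n) z) \<le> T" using T by auto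
      then have "zoom 1 (rate n) z $ e \<le> T" "zoom (-1) (rate n) z $ e \<le> T"
        using component_le_norm_cart[of "zoom 1 (rate n) z" e]
          component_le_norm_cart[of "zoom (-1) (rate n) z" e] by linarith+
      then have "rate n * b e \<le> T" by (simp add: zoom_def algebra_simps)
      then show False using elim(1) axes_pos[of e] by (simp add: field_simps)
    qed
    then have disj: "(solid \<inter> zoom 1 (rate n) -` U) \<inter> (solid \<inter> zoom (-1) (rate n) -` V) = {}" by blast
    have fin: "emeasure lborel (solid \<inter> A) \<noteq> \<infinity>" if "A \<in> sets borel" for A
    proof -
      have "emeasure lborel (solid \<inter> A) \<le> emeasure lborel solid" by (intro emeasure_mono) auto
      then show ?thesis using solid_measure(2) by (auto simp: top_unique)
    qed
    have "measure lborel (solid \<inter> (zoom 1 (rate n) -` U \<union> zoom (-1) (rate n) -` V))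
        = measure lborel (solid \<inter> zoom 1 (rate n) -` U) + measure lborel (solid \<inter> zoom (-1) (rate n) -` V)"
      unfolding Int_Un_distrib
      by (rule measure_Union) (use fin vim U V disj in auto)
    also have "\<dots> = m n U / real n + m n V / real n"
      using m_eq[OF elim(2), of 1 U] m_eq[OF elim(2), of "-1" V] U V by simp
    finally have "real n * measure lborel (solid \<inter> (zoom 1 (rate n) -` U \<union> zoom (-1) (rate n) -` V))
        = m n U + m n V" using elim(2) by (simp add: distrib_left)
    moreover have "zoom 1 (rate n) -` U \<union> zoom (-1) (rate n) -` V \<in> sets borel"
      using vim U V by blast
    ultimately show ?case by (simp add: measure_uniform_solid mult.left_commute[of "real n"])
  qed
  moreover have "(\<lambda>n. density_const * (m n U + m n V))
      \<longlonglongrightarrow> density_const * (measure lborel (parab \<inter> U) + measure lborel (parab \<inter> V))"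
    unfolding m_def rate_def
    by (intro tendsto_mult tendsto_add tendsto_const measure_zoomed_tendsto U V) simp_all
  ultimately show ?thesis by (rule Lim_transform_eventually[rotated])
qed

end


section \<open>Weak convergence of the rescaled deficit of the diameter\<close>

lemma cdf_distr:
  assumes "f \<in> borel_measurable M"
  shows "cdf (distr M borel f) t = measure M {\<omega> \<in> space M. f \<omega> \<le> t}"
proof -
  have "cdf (distr M borel f) t = measure M (f -` {..t} \<inter> space M)"
    unfolding cdf_def using assms by (intro measure_distr) auto
  also have "f -` {..t} \<inter> space M = {\<omega> \<in> space M. f \<omega> \<le> t}" by auto
  finally show ?thesis .
qed

context dominant_axis
begin

text \<open>The assumption \<open>avoid\<close> covers a fixed sample size \<open>n\<close> as well as a Poisson number of points
  with mean \<open>n\<close>.\<close>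

lemma diameter_weak_limit:
  fixes Z :: "nat \<Rightarrow> 'w \<Rightarrow> real ^ 'n" and \<nu> :: "nat \<Rightarrow> 'w \<Rightarrow> nat"
    and X Y :: "nat \<Rightarrow> 'v \<Rightarrow> real ^ 'n" and W :: "'v \<Rightarrow> real"
  assumes M: "prob_space M" and M': "prob_space M'"
    and Z_meas: "\<And>i. 1 \<le> i \<Longrightarrow> Z i \<in> borel_measurable M"
    and Z_solid: "\<And>i. 1 \<le> i \<Longrightarrow> AE \<omega> in M. Z i \<omega> \<in> solid"
    and \<nu>_meas: "\<And>n. \<nu> n \<in> measurable M (count_space UNIV)"
    and avoid: "\<And>B l. (\<And>n. B n \<in> sets borel) \<Longrightarrow>
        (\<lambda>n. real n * measure (uniform_measure lborel solid) (B n)) \<longlonglongrightarrow> l \<Longrightarrow>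
        (\<lambda>n. measure M {\<omega> \<in> space M. \<forall>i\<in>{1..\<nu> n \<omega>}. Z i \<omega> \<notin> B n}) \<longlonglongrightarrow> exp (- l)"
    and X_meas: "\<And>i. 1 \<le> i \<Longrightarrow> X i \<in> borel_measurable M'"
    and Y_meas: "\<And>i. 1 \<le> i \<Longrightarrow> Y i \<in> borel_measurable M'"
    and X_parab: "AE \<omega> in M'. \<forall>i\<ge>1. X i \<omega> \<in> parab"
    and Y_parab: "AE \<omega> in M'. \<forall>i\<ge>1. Y i \<omega> \<in> parab"
    and avoid': "\<And>U V. \<lbrakk>U \<in> sets borel; V \<in> sets borel; bounded U; bounded V\<rbrakk> \<Longrightarrow>
        measure M' {\<omega> \<in> space M'. (\<forall>i\<ge>1. X i \<omega> \<notin> U) \<and> (\<forall>i\<ge>1. Y i \<omega> \<notin> V)}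
        = exp (- (density_const * (measure lborel (parab \<inter> U) + measure lborel (parab \<inter> V))))"
    and W_meas: "W \<in> borel_measurable M'"
    and W_le: "AE \<omega> in M'. \<forall>i\<ge>1. \<forall>j\<ge>1. W \<omega> \<le> gap (X i \<omega>) (Y j \<omega>)"
    and W_attained: "AE \<omega> in M'. \<exists>i\<ge>1. \<exists>j\<ge>1. W \<omega> = gap (X i \<omega>) (Y j \<omega>)"
  shows "weak_conv_m
    (\<lambda>n. distr M borel (\<lambda>\<omega>. rate n * (2 * b e - max_dist (\<lambda>i. Z i \<omega>) (\<nu> n \<omega>))))
    (distr M' borel W)"
  unfolding weak_conv_m_def weak_conv_def
proof (intro allI impI)
  fix t assume cont: "isCont (cdf (distr M' borel W)) t"
  interpret M: prob_space M by fact
  interpret M': prob_space M' by fact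
  define D where "D n \<omega> = rate n * (2 * b e - max_dist (\<lambda>i. Z i \<omega>) (\<nu> n \<omega>))" for n \<omega>
  have D_meas: "D n \<in> borel_measurable M" for n
    unfolding D_def using max_dist_measurable[OF Z_meas \<nu>_meas]
    by (intro borel_measurable_times borel_measurable_diff) simp_all
  \<comment> \<open>The slab of this width serves both sides and does not depend on \<epsilon>. The
    width exceeds the bound 2 t / k for nearly extremal sample pairs, and by \<open>gap_ge\<close>
    the slab contains every pair of limit points whose \<open>gap\<close> is at most t.\<close>
  define T where "T = 2 * (\<bar>t\<bar> + 1) / eccentricity"
  \<comment> \<open>The Boolean tag tells the two vertices apart: \<open>True\<close> goes with
    \<open>zoom 1\<close> and \<open>X\<close>, \<open>False\<close> with \<open>zoom (-1)\<close>
    and \<open>Y\<close>. Cells at both vertices thus become elements of one finite set.\<close>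
  define sgn' :: "bool \<Rightarrow> real" where "sgn' s = (if s then 1 else -1)" for s
  define XY where "XY s = (if s then X else Y)" for s

  \<comment> \<open>Stated for arbitrary finite \<open>C\<close> and radius because the cells depend
    on \<epsilon>, which is chosen only later. \<open>S n\<close> and \<open>S'\<close> collect the
    tagged cells hit by the rescaled sample and by the two processes.\<close>
  have pattern: "\<exists>S S'. (\<forall>\<A>. {\<omega> \<in> space M'. S' \<omega> \<in> \<A>} \<in> sets M' \<and> (\<forall>n. {\<omega> \<in> space M. S n \<omega> \<in> \<A>} \<in> sets M) \<and>
        (\<lambda>n. measure M {\<omega> \<in> space M. S n \<omega> \<in> \<A>}) \<longlonglongrightarrow> measure M' {\<omega> \<in> space M'. S' \<omega> \<in> \<A>})
      \<and> (\<forall>n \<omega>. S n \<omega> = {(x, s). x \<in> C \<and> (\<exists>i\<in>{1..\<nu> n \<omega>}. zoom (sgn' s) (rate n) (Z i \<omega>) \<in> slab T \<inter> ball x \<delta>)})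
      \<and> (\<forall>\<omega>. S' \<omega> = {(x, s). x \<in> C \<and> (\<exists>i\<ge>1. XY s i \<omega> \<in> slab T \<inter> ball x \<delta>)})"
    if C: "finite C" for C \<delta>
  proof -
    define S where "S n \<omega> = {(x, s). x \<in> C \<and>
       (\<exists>i\<in>{1..\<nu> n \<omega>}. zoom (sgn' s) (rate n) (Z i \<omega>) \<in> slab T \<inter> ball x \<delta>)}" for n \<omega>
    define S' where "S' \<omega> = {(x, s). x \<in> C \<and> (\<exists>i\<ge>1. XY s i \<omega> \<in> slab T \<inter> ball x \<delta>)}" for \<omega>
    define I where "I = C \<times> (UNIV :: bool set)"
    have I: "finite I" using C by (simp add: I_def)
    have cell: "slab T \<inter> ball x \<delta> \<in> sets borel" for x by auto
    have S_meas: "{\<omega> \<in> space M. i \<in> S n \<omega>} \<in> sets M" if i_in: "i \<in> I" for n i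
    proof -
      obtain x s where i: "i = (x, s)" "x \<in> C" using i_in by (auto simp: I_def)
      have "{\<omega> \<in> space M. zoom (sgn' s) (rate n) (Z k \<omega>) \<in> slab T \<inter> ball x \<delta>} \<in> sets M"
        if "1 \<le> k" for k
      proof -
        have "(\<lambda>\<omega>. zoom (sgn' s) (rate n) (Z k \<omega>)) \<in> borel_measurable M"
          using measurable_compose[OF Z_meas[OF that] zoom_measurable] .
        from measurable_sets[OF this cell[of x]] show ?thesis
          by (simp add: vimage_def Int_def conj_commute)
      qed
      from sets_ex_random_index[OF this \<nu>_meas[of n]] i(2) show ?thesis
        unfolding i(1) S_def by simp
    qed
    have S'_meas: "{\<omega> \<in> space M'. i \<in> S' \<omega>} \<in> sets M'" if i_in: "i \<in> I" for i
    proof -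
      obtain x s where i: "i = (x, s)" "x \<in> C" using i_in by (auto simp: I_def)
      have XY: "XY s k \<in> borel_measurable M'" if "1 \<le> k" for k
        using X_meas Y_meas that by (simp add: XY_def)
      have "{\<omega> \<in> space M'. i \<in> S' \<omega>} = (\<Union>k\<in>{1..}. XY s k -` (slab T \<inter> ball x \<delta>) \<inter> space M')"
        using i by (auto simp: S'_def)
      also have "\<dots> \<in> sets M'"
        using measurable_sets[OF XY cell] by (intro sets.countable_UN') auto
      finally show ?thesis .
    qed
    have avoids: "(\<lambda>n. measure M {\<omega> \<in> space M. S n \<omega> \<inter> V = {}})
        \<longlonglongrightarrow> measure M' {\<omega> \<in> space M'. S' \<omega> \<inter> V = {}}" if V: "V \<subseteq> I" for V
    proof -
      define U where "U s = (\<Union>x\<in>{x. (x, s) \<in> V}. slab T \<inter> ball x \<delta>)" for s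
      have fin: "finite {x. (x, s) \<in> V}" for s
        using V by (intro finite_subset[OF _ C]) (auto simp: I_def)
      have U_borel: "U s \<in> sets borel" for s
        unfolding U_def using fin cell by (intro sets.finite_UN) auto
      have "bounded (slab T)" using slab_compact by (rule compact_imp_bounded)
      then have U_bounded: "bounded (U s)" for s
        by (rule bounded_subset) (auto simp: U_def)
      \<comment> \<open>A point avoids the forbidden cells in both blow-ups exactly if it avoids
        this one set, so missing the tagged cells in \<open>V\<close> becomes the event in the
        hypothesis \<open>avoid\<close>.\<close>
      define B where "B n = zoom 1 (rate n) -` U True \<union> zoom (-1) (rate n) -` U False" for n
      have B_borel: "B n \<in> sets borel" for n
        using measurable_sets[OF zoom_measurable[of 1 "rate n"] U_borel[of True]]
          measurable_sets[OF zoom_measurable[of "-1" "rate n"] U_borel[of False]] by (simp add: B_def)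
      have "S n \<omega> \<inter> V = {} \<longleftrightarrow> (\<forall>i\<in>{1..\<nu> n \<omega>}. Z i \<omega> \<notin> B n)" for n \<omega>
      proof -
        have "S n \<omega> \<inter> V = {} \<longleftrightarrow> (\<forall>i\<in>{1..\<nu> n \<omega>}. \<forall>s. zoom (sgn' s) (rate n) (Z i \<omega>) \<notin> U s)"
          using V by (auto simp: S_def U_def I_def)
        then show ?thesis by (simp add: B_def sgn'_def all_bool_eq)
      qed
      moreover have "S' \<omega> \<inter> V = {} \<longleftrightarrow> (\<forall>i\<ge>1. X i \<omega> \<notin> U True) \<and> (\<forall>i\<ge>1. Y i \<omega> \<notin> U False)" for \<omega>
      proof -
        have "S' \<omega> \<inter> V = {} \<longleftrightarrow> (\<forall>s. \<forall>i\<ge>1. XY s i \<omega> \<notin> U s)"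
          using V by (auto simp: S'_def U_def I_def)
        then show ?thesis by (simp add: XY_def all_bool_eq conj_commute)
      qed
      ultimately show ?thesis
        using avoid[of B, OF B_borel hitting_rate_tendsto[OF U_borel U_bounded U_borel U_bounded, of True False, folded B_def]]
          avoid'[OF U_borel U_borel U_bounded U_bounded, of True False]
        by simp
    qed
    have sub: "S n \<omega> \<subseteq> I" for n \<omega> by (auto simp: S_def I_def)
    have sub': "S' \<omega> \<subseteq> I" for \<omega> by (auto simp: S'_def I_def)
    have conv: "{\<omega> \<in> space M'. S' \<omega> \<in> \<A>} \<in> sets M' \<and> (\<forall>n. {\<omega> \<in> space M. S n \<omega> \<in> \<A>} \<in> sets M) \<and>
        (\<lambda>n. measure M {\<omega> \<in> space M. S n \<omega> \<in> \<A>}) \<longlonglongrightarrow> measure M' {\<omega> \<in> space M'. S' \<omega> \<in> \<A>}" for \<A>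
    proof (intro conjI allI)
      show "{\<omega> \<in> space M'. S' \<omega> \<in> \<A>} \<in> sets M'"
        by (rule measure_pattern_sum(1)[OF M'.finite_measure_axioms I S'_meas sub'])
      show "{\<omega> \<in> space M. S n \<omega> \<in> \<A>} \<in> sets M" for n
        by (rule measure_pattern_sum(1)[OF M.finite_measure_axioms I S_meas sub])
      show "(\<lambda>n. measure M {\<omega> \<in> space M. S n \<omega> \<in> \<A>}) \<longlonglongrightarrow> measure M' {\<omega> \<in> space M'. S' \<omega> \<in> \<A>}"
        by (rule random_subset_tendsto[OF M.finite_measure_axioms M'.finite_measure_axioms I
          S_meas S'_meas sub sub' avoids])
    qed
    show ?thesis
      by (rule exI[of _ S], rule exI[of _ S'], intro conjI[OF allI[OF conv]] conjI allI)
        (rule S_def, rule S'_def)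
  qed
  have small: "\<forall>\<^sub>F n in sequentially. k / rate n < \<eta>" if "0 < \<eta>" for k \<eta> :: real
    by (rule order_tendstoD(2)[OF real_tendsto_divide_at_top[OF tendsto_const rate_at_top] that])
  have rate_pos: "\<forall>\<^sub>F n in sequentially. 0 < rate n"
    using rate_at_top by (simp add: filterlim_at_top_dense)
  have Z_all: "AE \<omega> in M. \<forall>i\<in>{1..}. Z i \<omega> \<in> solid"
    by (rule AE_ball_countable') (use Z_solid in auto)
  have W_sets: "{\<omega> \<in> space M'. W \<omega> \<le> s} \<in> sets M'" for s
    using W_meas by measurable
  have D_sets: "{\<omega> \<in> space M. D n \<omega> \<le> s} \<in> sets M" for n s
    using D_meas[of n] by measurable
  \<comment> \<open>Uniform continuity of \<open>gap\<close> on the slab fixes \<delta>; balls of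
    radius \<delta> / 2 keep two points of one cell within \<delta> of each other.\<close>
  have cells: "\<exists>C r. finite C \<and> slab T \<subseteq> (\<Union>x\<in>C. ball x r) \<and>
      (\<forall>x y u v u' v'. u \<in> slab T \<inter> ball x r \<longrightarrow> u' \<in> slab T \<inter> ball x r \<longrightarrow>
         v \<in> slab T \<inter> ball y r \<longrightarrow> v' \<in> slab T \<inter> ball y r \<longrightarrow> gap u v < gap u' v' + \<epsilon>)"
    if \<epsilon>: "0 < \<epsilon>" for \<epsilon>
  proof -
    obtain \<delta> where \<delta>: "0 < \<delta>" "\<And>u v u' v'. \<lbrakk>u \<in> slab T; v \<in> slab T; u' \<in> slab T; v' \<in> slab T;
        dist u u' < \<delta>; dist v v' < \<delta>\<rbrakk> \<Longrightarrow> \<bar>gap u v - gap u' v'\<bar> < \<epsilon>"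
      using gap_uniformly_continuous[OF \<epsilon>] by metis
    have "0 < \<delta> / 2" using \<delta>(1) by simp
    then obtain C where C: "finite C" "slab T \<subseteq> (\<Union>x\<in>C. ball x (\<delta> / 2))"
      using slab_compact[of T] unfolding compact_eq_totally_bounded by blast
    have near: "dist u u' < \<delta>" if "u \<in> ball x (\<delta> / 2)" "u' \<in> ball x (\<delta> / 2)" for u u' x
      using that dist_triangle_less_add[of u x "\<delta> / 2" u' "\<delta> / 2"] by (simp add: dist_commute)
    have "gap u v < gap u' v' + \<epsilon>"
      if "u \<in> slab T \<inter> ball x (\<delta> / 2)" "u' \<in> slab T \<inter> ball x (\<delta> / 2)"
        "v \<in> slab T \<inter> ball y (\<delta> / 2)" "v' \<in> slab T \<inter> ball y (\<delta> / 2)" for x y u v u' v'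
    proof -
      have "\<bar>gap u v - gap u' v'\<bar> < \<epsilon>"
        by (rule \<delta>(2)) (use that near in blast)+
      then show ?thesis by linarith
    qed
    then show ?thesis using C by blast
  qed

  have sandwich: "(\<lambda>n. measure M {\<omega> \<in> space M. D n \<omega> \<le> t}) \<longlonglongrightarrow> cdf (distr M' borel W) t"
  proof (rule tendsto_sandwich_isCont[OF cont])
    fix \<epsilon> :: real assume \<epsilon>: "0 < \<epsilon>" "\<epsilon> < 1"
    \<comment> \<open>One half of \<epsilon> pays for the variation of \<open>gap\<close> within
      cells, the other for the error terms of order 1 / \<open>rate n\<close>.\<close>
    define h where "h = \<epsilon> / 2"
    have h: "0 < h" "\<epsilon> = h + h" using \<epsilon> by (auto simp: h_def)
    obtain C r where C: "finite C" and cover: "slab T \<subseteq> (\<Union>x\<in>C. ball x r)"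
      and osc: "\<And>x y u v u' v'. \<lbrakk>u \<in> slab T \<inter> ball x r; u' \<in> slab T \<inter> ball x r;
         v \<in> slab T \<inter> ball y r; v' \<in> slab T \<inter> ball y r\<rbrakk> \<Longrightarrow> gap u v < gap u' v' + h"
      using cells[OF h(1)] by metis
    from pattern[OF C, of r] obtain S S' where
      S'_sets: "\<And>\<A>. {\<omega> \<in> space M'. S' \<omega> \<in> \<A>} \<in> sets M'" and
      S_sets: "\<And>\<A> n. {\<omega> \<in> space M. S n \<omega> \<in> \<A>} \<in> sets M" and
      S_lim: "\<And>\<A>. (\<lambda>n. measure M {\<omega> \<in> space M. S n \<omega> \<in> \<A>}) \<longlonglongrightarrow> measure M' {\<omega> \<in> space M'. S' \<omega> \<in> \<A>}" and
      S: "\<And>n \<omega>. S n \<omega> = {(x, s). x \<in> C \<and> (\<exists>i\<in>{1..\<nu> n \<omega>}. zoom (sgn' s) (rate n) (Z i \<omega>) \<in> slab T \<inter> ball x r)}" and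
      S': "\<And>\<omega>. S' \<omega> = {(x, s). x \<in> C \<and> (\<exists>i\<ge>1. XY s i \<omega> \<in> slab T \<inter> ball x r)}"
      by (elim exE conjE) blast
    \<comment> \<open>A pattern belongs to this family if two of its cells with opposite tags
      contain some points, not necessarily the random ones, whose \<open>gap\<close> is at most s.
      Membership depends on the cells alone, and all points of these two cells then have
      \<open>gap\<close> below s + h.\<close>
    define \<A> where "\<A> s = {A :: ((real ^ 'n) \<times> bool) set. \<exists>x y. (x, True) \<in> A \<and> (y, False) \<in> A \<and>
        (\<exists>u\<in>slab T \<inter> ball x r. \<exists>v\<in>slab T \<inter> ball y r. gap u v \<le> s)}" for s
    have \<A>I: "A \<in> \<A> s" if "(x, True) \<in> A" "(y, False) \<in> A" "u \<in> slab T \<inter> ball x r"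
        "v \<in> slab T \<inter> ball y r" "gap u v \<le> s" for A s x y u v
      using that unfolding \<A>_def by blast
    have S_\<A>: "\<exists>i\<in>{1..\<nu> n \<omega>}. \<exists>j\<in>{1..\<nu> n \<omega>}.
        gap (zoom 1 (rate n) (Z i \<omega>)) (zoom (-1) (rate n) (Z j \<omega>)) < s + h" if hit: "S n \<omega> \<in> \<A> s" for n \<omega> s
    proof -
      obtain x y u v where *: "(x, True) \<in> S n \<omega>" "(y, False) \<in> S n \<omega>" "u \<in> slab T \<inter> ball x r"
        "v \<in> slab T \<inter> ball y r" "gap u v \<le> s" using hit unfolding \<A>_def by blast
      obtain i where i: "i \<in> {1..\<nu> n \<omega>}" "zoom 1 (rate n) (Z i \<omega>) \<in> slab T \<inter> ball x r"
        using *(1) unfolding S by (auto simp: sgn'_def)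
      obtain j where j: "j \<in> {1..\<nu> n \<omega>}" "zoom (-1) (rate n) (Z j \<omega>) \<in> slab T \<inter> ball y r"
        using *(2) unfolding S by (auto simp: sgn'_def)
      have "gap (zoom 1 (rate n) (Z i \<omega>)) (zoom (-1) (rate n) (Z j \<omega>)) < gap u v + h"
        by (rule osc[OF i(2) *(3) j(2) *(4)])
      then have "gap (zoom 1 (rate n) (Z i \<omega>)) (zoom (-1) (rate n) (Z j \<omega>)) < s + h" using *(5) by linarith
      then show ?thesis using i(1) j(1) by blast
    qed
    have S'_\<A>: "\<exists>i\<ge>1. \<exists>j\<ge>1. gap (X i \<omega>) (Y j \<omega>) < s + h" if hit: "S' \<omega> \<in> \<A> s" for \<omega> s
    proof -
      obtain x y u v where *: "(x, True) \<in> S' \<omega>" "(y, False) \<in> S' \<omega>" "u \<in> slab T \<inter> ball x r"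
        "v \<in> slab T \<inter> ball y r" "gap u v \<le> s" using hit unfolding \<A>_def by blast
      obtain i where i: "1 \<le> i" "X i \<omega> \<in> slab T \<inter> ball x r"
        using *(1) unfolding S' by (auto simp: XY_def)
      obtain j where j: "1 \<le> j" "Y j \<omega> \<in> slab T \<inter> ball y r"
        using *(2) unfolding S' by (auto simp: XY_def)
      have "gap (X i \<omega>) (Y j \<omega>) < gap u v + h"
        by (rule osc[OF i(2) *(3) j(2) *(4)])
      then have "gap (X i \<omega>) (Y j \<omega>) < s + h" using *(5) by linarith
      then show ?thesis using i(1) j(1) by blast
    qed
    have cell: "\<exists>x\<in>C. u \<in> slab T \<inter> ball x r" if "u \<in> slab T" for u
      using cover that by blast
    have t_T: "2 * t / eccentricity \<le> T"
      unfolding T_def using eccentricity_pos by (intro divide_right_mono) auto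

    \<comment> \<open>Upper bound: for large n a deficit at most t puts the cells of a far pair into
      a pattern of \<open>\<A> (t + h)\<close>, and such a pattern on the limit side forces
      \<open>W\<close> below t + 2 h = t + \<epsilon>.\<close>
    show "\<exists>g l. g \<longlonglongrightarrow> l \<and> (\<forall>\<^sub>F n in sequentially. measure M {\<omega> \<in> space M. D n \<omega> \<le> t} \<le> g n)
        \<and> l \<le> cdf (distr M' borel W) (t + \<epsilon>)"
    proof (intro exI conjI)
      show "(\<lambda>n. measure M {\<omega> \<in> space M. S n \<omega> \<in> \<A> (t + h)})
          \<longlonglongrightarrow> measure M' {\<omega> \<in> space M'. S' \<omega> \<in> \<A> (t + h)}" by (rule S_lim)
      have "AE \<omega> in M'. \<omega> \<in> {\<omega> \<in> space M'. S' \<omega> \<in> \<A> (t + h)} \<longrightarrow> \<omega> \<in> {\<omega> \<in> space M'. W \<omega> \<le> t + \<epsilon>}"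
        using W_le
      proof eventually_elim
        case (elim \<omega>)
        show ?case
        proof
          assume \<omega>: "\<omega> \<in> {\<omega> \<in> space M'. S' \<omega> \<in> \<A> (t + h)}"
          then obtain i j where "1 \<le> i" "1 \<le> j" "gap (X i \<omega>) (Y j \<omega>) < t + h + h"
            using S'_\<A> by blast
          moreover from this elim have "W \<omega> \<le> gap (X i \<omega>) (Y j \<omega>)" by blast
          ultimately show "\<omega> \<in> {\<omega> \<in> space M'. W \<omega> \<le> t + \<epsilon>}" using \<omega> h(2) by simp
        qed
      qed
      then show "measure M' {\<omega> \<in> space M'. S' \<omega> \<in> \<A> (t + h)} \<le> cdf (distr M' borel W) (t + \<epsilon>)"
        unfolding cdf_distr[OF W_meas] using W_sets by (rule M'.finite_measure_mono_AE)
      have "\<forall>\<^sub>F n in sequentially. t / rate n < 2 * b e"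
        by (rule small) (use axes_pos[of e] in simp)
      moreover have "\<forall>\<^sub>F n in sequentially. (2 * t / eccentricity)\<^sup>2 / (4 * b e) / rate n < h"
        by (rule small) (rule h)
      ultimately show "\<forall>\<^sub>F n in sequentially. measure M {\<omega> \<in> space M. D n \<omega> \<le> t}
          \<le> measure M {\<omega> \<in> space M. S n \<omega> \<in> \<A> (t + h)}"
        using rate_pos
      proof eventually_elim
        case n: (elim n)
        show ?case
        proof (rule M.finite_measure_mono_AE[OF _ S_sets])
          show "AE \<omega> in M. \<omega> \<in> {\<omega> \<in> space M. D n \<omega> \<le> t} \<longrightarrow> \<omega> \<in> {\<omega> \<in> space M. S n \<omega> \<in> \<A> (t + h)}"
            using Z_all
          proof eventually_elim
            case \<omega>: (elim \<omega>)
            show ?case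
            proof
              assume \<omega>_in: "\<omega> \<in> {\<omega> \<in> space M. D n \<omega> \<le> t}"
              then have deficit: "rate n * (2 * b e - max_dist (\<lambda>i. Z i \<omega>) (\<nu> n \<omega>)) \<le> t"
                by (simp add: D_def)
              have solid: "Z i \<omega> \<in> solid" if "i \<in> {1..\<nu> n \<omega>}" for i using \<omega> that by simp
              obtain i j where i: "i \<in> {1..\<nu> n \<omega>}" "zoom 1 (rate n) (Z i \<omega>) \<in> slab T"
                and j: "j \<in> {1..\<nu> n \<omega>}" "zoom (-1) (rate n) (Z j \<omega>) \<in> slab T"
                and gap: "gap (zoom 1 (rate n) (Z i \<omega>)) (zoom (-1) (rate n) (Z j \<omega>))
                    \<le> t + (2 * t / eccentricity)\<^sup>2 / (4 * b e * rate n)"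
                using max_dist_small_deficitD[OF n(3) solid deficit n(1) t_T] by metis
              obtain x where x: "x \<in> C" "zoom 1 (rate n) (Z i \<omega>) \<in> slab T \<inter> ball x r"
                using cell[OF i(2)] by blast
              obtain y where y: "y \<in> C" "zoom (-1) (rate n) (Z j \<omega>) \<in> slab T \<inter> ball y r"
                using cell[OF j(2)] by blast
              have "(x, True) \<in> S n \<omega>" using x i(1) unfolding S by (auto simp: sgn'_def)
              moreover have "(y, False) \<in> S n \<omega>" using y j(1) unfolding S by (auto simp: sgn'_def)
              moreover have "gap (zoom 1 (rate n) (Z i \<omega>)) (zoom (-1) (rate n) (Z j \<omega>)) \<le> t + h"
                using gap n(2) by (simp only: divide_divide_eq_left)
              ultimately have "S n \<omega> \<in> \<A> (t + h)" using x(2) y(2) by (intro \<A>I)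
              then show "\<omega> \<in> {\<omega> \<in> space M. S n \<omega> \<in> \<A> (t + h)}" using \<omega>_in by simp
            qed
          qed
        qed
      qed
    qed

    \<comment> \<open>Lower bound: nothing is lost on the limit side, because the pair attaining
      \<open>W\<close> itself witnesses \<open>\<A> (t - \<epsilon>)\<close>; this is where
      attainment of the minimum enters. On the sample side the cells give a pair with
      \<open>gap\<close> below t - h, and the remaining h covers the correction in
      \<open>max_dist_small_deficitI\<close>.\<close>
    show "\<exists>g l. g \<longlonglongrightarrow> l \<and> (\<forall>\<^sub>F n in sequentially. g n \<le> measure M {\<omega> \<in> space M. D n \<omega> \<le> t})
        \<and> cdf (distr M' borel W) (t - \<epsilon>) \<le> l"
    proof (intro exI conjI)
      show "(\<lambda>n. measure M {\<omega> \<in> space M. S n \<omega> \<in> \<A> (t - \<epsilon>)})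
          \<longlonglongrightarrow> measure M' {\<omega> \<in> space M'. S' \<omega> \<in> \<A> (t - \<epsilon>)}" by (rule S_lim)
      have "AE \<omega> in M'. \<omega> \<in> {\<omega> \<in> space M'. W \<omega> \<le> t - \<epsilon>} \<longrightarrow> \<omega> \<in> {\<omega> \<in> space M'. S' \<omega> \<in> \<A> (t - \<epsilon>)}"
        using W_attained X_parab Y_parab
      proof eventually_elim
        case (elim \<omega>)
        show ?case
        proof
          assume \<omega>: "\<omega> \<in> {\<omega> \<in> space M'. W \<omega> \<le> t - \<epsilon>}"
          obtain i j where ij: "1 \<le> i" "1 \<le> j" "W \<omega> = gap (X i \<omega>) (Y j \<omega>)" using elim(1) by blast
          have parab: "X i \<omega> \<in> parab" "Y j \<omega> \<in> parab" using elim(2,3) ij by auto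
          have gap: "gap (X i \<omega>) (Y j \<omega>) \<le> t - \<epsilon>" using \<omega> ij(3) by simp
          have "eccentricity * (X i \<omega> $ e + Y j \<omega> $ e) \<le> 2 * (\<bar>t\<bar> + 1)"
          proof (rule order_trans[OF order_trans[OF gap_ge[OF parab] gap]])
            show "t - \<epsilon> \<le> 2 * (\<bar>t\<bar> + 1)" using \<epsilon>(1) by (simp add: abs_if)
          qed
          then have "X i \<omega> $ e + Y j \<omega> $ e \<le> T"
            unfolding T_def using eccentricity_pos by (simp add: pos_le_divide_eq mult.commute)
          then have "X i \<omega> \<in> slab T" "Y j \<omega> \<in> slab T"
            using parab parab_axis_nonneg[OF parab(1)] parab_axis_nonneg[OF parab(2)]
            by (auto simp: slab_def)
          then obtain x y where x: "x \<in> C" "X i \<omega> \<in> slab T \<inter> ball x r"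
            and y: "y \<in> C" "Y j \<omega> \<in> slab T \<inter> ball y r" using cell by metis
          have "(x, True) \<in> S' \<omega>" using x ij unfolding S' by (auto simp: XY_def)
          moreover have "(y, False) \<in> S' \<omega>" using y ij unfolding S' by (auto simp: XY_def)
          ultimately have "S' \<omega> \<in> \<A> (t - \<epsilon>)" using x(2) y(2) gap by (intro \<A>I)
          then show "\<omega> \<in> {\<omega> \<in> space M'. S' \<omega> \<in> \<A> (t - \<epsilon>)}" using \<omega> by simp
        qed
      qed
      then show "cdf (distr M' borel W) (t - \<epsilon>) \<le> measure M' {\<omega> \<in> space M'. S' \<omega> \<in> \<A> (t - \<epsilon>)}"
        unfolding cdf_distr[OF W_meas] using S'_sets by (rule M'.finite_measure_mono_AE)
      have "\<forall>\<^sub>F n in sequentially. t\<^sup>2 / (4 * b e) / rate n < h"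
        by (rule small) (rule h)
      then show "\<forall>\<^sub>F n in sequentially. measure M {\<omega> \<in> space M. S n \<omega> \<in> \<A> (t - \<epsilon>)}
          \<le> measure M {\<omega> \<in> space M. D n \<omega> \<le> t}"
        using rate_pos
      proof eventually_elim
        case n: (elim n)
        show ?case
        proof (rule M.finite_measure_mono[OF _ D_sets], rule subsetI)
          fix \<omega> assume \<omega>: "\<omega> \<in> {\<omega> \<in> space M. S n \<omega> \<in> \<A> (t - \<epsilon>)}"
          then obtain i j where ij: "i \<in> {1..\<nu> n \<omega>}" "j \<in> {1..\<nu> n \<omega>}"
            and gap: "gap (zoom 1 (rate n) (Z i \<omega>)) (zoom (-1) (rate n) (Z j \<omega>)) < t - \<epsilon> + h"
            using S_\<A> by blast
          have "gap (zoom 1 (rate n) (Z i \<omega>)) (zoom (-1) (rate n) (Z j \<omega>)) \<le> t - t\<^sup>2 / (4 * b e * rate n)"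
            using gap n(1) h(2) unfolding divide_divide_eq_left by linarith
          then have "D n \<omega> \<le> t"
            unfolding D_def by (rule max_dist_small_deficitI[OF n(2) ij])
          then show "\<omega> \<in> {\<omega> \<in> space M. D n \<omega> \<le> t}" using \<omega> by simp
        qed
      qed
    qed
  qed
  have "(\<lambda>\<omega>. rate n * (2 * b e - max_dist (\<lambda>i. Z i \<omega>) (\<nu> n \<omega>))) = D n" for n
    by (rule ext) (simp only: D_def)
  with sandwich show "(\<lambda>n. cdf (distr M borel (\<lambda>\<omega>. rate n * (2 * b e - max_dist (\<lambda>i. Z i \<omega>) (\<nu> n \<omega>)))) t)
      \<longlonglongrightarrow> cdf (distr M' borel W) t"
    by (simp only: cdf_distr[OF D_meas])
qed

end


section \<open>Poisson processes given by an enumeration of their points\<close>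

lemma emeasure_density_indicator:
  assumes "P \<in> sets borel" "B \<in> sets borel"
  shows "emeasure (density lborel (\<lambda>z. ennreal p * indicator P z)) B = ennreal p * emeasure lborel (P \<inter> B)"
proof -
  have "emeasure (density lborel (\<lambda>z. ennreal p * indicator P z)) B
      = (\<integral>\<^sup>+ z. ennreal p * indicator P z * indicator B z \<partial>lborel)"
    using assms by (intro emeasure_density) auto
  also have "\<dots> = (\<integral>\<^sup>+ z. ennreal p * indicator (P \<inter> B) z \<partial>lborel)"
    by (rule nn_integral_cong) (auto simp: indicator_def)
  also have "\<dots> = ennreal p * emeasure lborel (P \<inter> B)"
    using assms by (intro nn_integral_cmult_indicator) auto
  finally show ?thesis .
qed

lemma point_count_eq_0_iff: "point_count X B \<omega> = 0 \<longleftrightarrow> (\<forall>i\<ge>1. X i \<omega> \<notin> B)"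
proof -
  have "point_count X B \<omega> = 0 \<longleftrightarrow> {i. 1 \<le> i \<and> X i \<omega> \<in> B} = {}"
    unfolding point_count_def by (rule emeasure_count_space_eq_0[THEN trans]) auto
  then show ?thesis by blast
qed

context prob_space
begin

text \<open>Measurability of a single count is contained in the independence clause, read for a
  family with one member.\<close>

lemma poisson_process_count_measurable:
  assumes X: "poisson_process M \<Lambda> X" and B: "B \<in> sets \<Lambda>"
  shows "point_count X B \<in> borel_measurable M"
proof -
  have "\<forall>(C :: nat \<Rightarrow> _) m. C ` {..<m} \<subseteq> sets \<Lambda> \<longrightarrow> disjoint_family_on C {..<m} \<longrightarrow>
        indep_vars (\<lambda>_. borel) (\<lambda>k. point_count X (C k)) {..<m}"
    using X unfolding poisson_process_def by (elim conjE)
  from this[rule_format, of "\<lambda>_. B" 1] have "indep_vars (\<lambda>_. borel) (\<lambda>k. point_count X B) {..<1::nat}"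
    using B by (auto simp: disjoint_family_on_def)
  then show ?thesis by (auto simp: indep_vars_def)
qed

lemma poisson_process_prob_count:
  assumes X: "poisson_process M \<Lambda> X" and B: "B \<in> sets \<Lambda>" "emeasure \<Lambda> B < \<infinity>"
  shows "prob {\<omega> \<in> space M. point_count X B \<omega> = of_nat k} = measure \<Lambda> B ^ k / fact k * exp (- measure \<Lambda> B)"
  using X B unfolding poisson_process_def by (elim conjE) blast

text \<open>With mean 0 the Poisson weight at k = 0 is 0^0 = 1, so the count vanishes almost
  surely.\<close>

lemma poisson_process_avoid_null:
  assumes X: "poisson_process M \<Lambda> X" and B: "B \<in> sets \<Lambda>" and null: "emeasure \<Lambda> B = 0"
  shows "AE \<omega> in M. \<forall>i\<ge>1. X i \<omega> \<notin> B"
proof -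
  have "measure \<Lambda> B = 0" using null by (simp add: measure_def)
  then have 1: "prob {\<omega> \<in> space M. point_count X B \<omega> = 0} = 1"
    using poisson_process_prob_count[OF X B, of 0] null by simp
  have "{\<omega> \<in> space M. point_count X B \<omega> = 0} \<in> events"
    using poisson_process_count_measurable[OF X B] by measurable
  then have "AE \<omega> in M. \<omega> \<in> {\<omega> \<in> space M. point_count X B \<omega> = 0}"
    using 1 by (simp only: AE_in_set_eq_1)
  then show ?thesis by (rule eventually_mono) (auto simp: point_count_eq_0_iff)
qed

text \<open>The Poisson weights add up to 1, so almost surely the count is some natural number,
  whereas infinitely many indices in B would make it infinite.\<close>

lemma poisson_process_locally_finite:
  assumes X: "poisson_process M \<Lambda> X" and B: "B \<in> sets \<Lambda>" and fin: "emeasure \<Lambda> B < \<infinity>"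
  shows "AE \<omega> in M. finite {i. 1 \<le> i \<and> X i \<omega> \<in> B}"
proof -
  define A where "A k = {\<omega> \<in> space M. point_count X B \<omega> = of_nat k}" for k
  have A: "A k \<in> events" for k
    unfolding A_def using poisson_process_count_measurable[OF X B] by measurable
  have "(\<lambda>k. prob (A k)) sums prob (\<Union>k. A k)"
    using A by (intro finite_measure_UNION) (auto simp: disjoint_family_on_def A_def)
  moreover have "(\<lambda>k. prob (A k)) sums (exp (measure \<Lambda> B) * exp (- measure \<Lambda> B))"
    unfolding A_def poisson_process_prob_count[OF X B fin]
    using exp_converges[of "measure \<Lambda> B"]
    by (intro sums_mult2) (simp add: divide_inverse mult.commute scaleR_conv_of_real)
  ultimately have "prob (\<Union>k. A k) = exp (measure \<Lambda> B) * exp (- measure \<Lambda> B)" by (rule sums_unique2)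
  then have "prob (\<Union>k. A k) = 1" by (simp add: exp_minus)
  moreover have "(\<Union>k. A k) \<in> events" using A by blast
  ultimately have "AE \<omega> in M. \<omega> \<in> (\<Union>k. A k)" by (simp only: AE_in_set_eq_1)
  then show ?thesis
  proof eventually_elim
    case (elim \<omega>)
    then obtain k where k: "point_count X B \<omega> = of_nat k" by (auto simp: A_def)
    show ?case
    proof (rule ccontr)
      assume "infinite {i. 1 \<le> i \<and> X i \<omega> \<in> B}"
      then have "point_count X B \<omega> = \<infinity>" by (simp add: point_count_def)
      with k show False by simp
    qed
  qed
qed

text \<open>Evaluation at \<open>U\<close> and \<open>V\<close> projects the independent families of
  counts to two independent variables, and the event says that both vanish.\<close>

lemma indep_poisson_processes_avoid:
  assumes X: "poisson_process M \<Lambda> X" and Y: "poisson_process M \<Lambda> Y"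
    and indep: "indep_point_processes M S X Y"
    and S: "sets S = sets \<Lambda>"
    and U: "U \<in> sets \<Lambda>" "emeasure \<Lambda> U < \<infinity>" and V: "V \<in> sets \<Lambda>" "emeasure \<Lambda> V < \<infinity>"
  shows "prob {\<omega> \<in> space M. (\<forall>i\<ge>1. X i \<omega> \<notin> U) \<and> (\<forall>i\<ge>1. Y i \<omega> \<notin> V)}
    = exp (- (measure \<Lambda> U + measure \<Lambda> V))"
proof -
  have comp: "(\<lambda>f. f B) \<in> measurable (PiM (sets S) (\<lambda>_. borel :: ennreal measure)) borel" if "B \<in> sets \<Lambda>" for B
    using that S by (intro measurable_component_singleton) simp
  have "indep_var borel ((\<lambda>f. f U) \<circ> (\<lambda>\<omega>. \<lambda>B\<in>sets S. point_count X B \<omega>))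
      borel ((\<lambda>f. f V) \<circ> (\<lambda>\<omega>. \<lambda>B\<in>sets S. point_count Y B \<omega>))"
    using indep unfolding indep_point_processes_def
    by (rule indep_var_compose) (rule comp[OF U(1)], rule comp[OF V(1)])
  then have iv: "indep_var borel (point_count X U) borel (point_count Y V)"
    using U V S by (simp add: comp_def)
  have "prob ((\<lambda>\<omega>. (point_count X U \<omega>, point_count Y V \<omega>)) -` ({0} \<times> {0}) \<inter> space M)
      = prob (point_count X U -` {0} \<inter> space M) * prob (point_count Y V -` {0} \<inter> space M)"
    by (rule indep_varD[OF iv]) auto
  moreover have "(\<lambda>\<omega>. (point_count X U \<omega>, point_count Y V \<omega>)) -` ({0} \<times> {0}) \<inter> space M
      = {\<omega> \<in> space M. (\<forall>i\<ge>1. X i \<omega> \<notin> U) \<and> (\<forall>i\<ge>1. Y i \<omega> \<notin> V)}"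
    by (auto simp: point_count_eq_0_iff)
  moreover have "prob (point_count X U -` {0} \<inter> space M) = exp (- measure \<Lambda> U)"
    using poisson_process_prob_count[OF X U, of 0] by (simp add: vimage_def Int_def conj_commute)
  moreover have "prob (point_count Y V -` {0} \<inter> space M) = exp (- measure \<Lambda> V)"
    using poisson_process_prob_count[OF Y V, of 0] by (simp add: vimage_def Int_def conj_commute)
  ultimately show ?thesis by (simp add: exp_add[symmetric])
qed

end

section \<open>The minimum over pairs of points of the two processes\<close>

context dominant_axis
begin

text \<open>The value v at the pair (1, 1) serves as a threshold. By \<open>gap_ge\<close> the pairs
  with value at most v have both members in one slab, so there are finitely many of them, and a
  minimiser among these is a global one. Slab widths are natural numbers so that finiteness for all
  of them holds almost surely by countability.\<close>

lemma gap_minimum_exists: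
  fixes x y :: "nat \<Rightarrow> real ^ 'n"
  assumes x: "\<And>i. 1 \<le> i \<Longrightarrow> x i \<in> parab" and y: "\<And>i. 1 \<le> i \<Longrightarrow> y i \<in> parab"
    and x_fin: "\<And>m::nat. finite {i. 1 \<le> i \<and> x i \<in> slab (real m)}"
    and y_fin: "\<And>m::nat. finite {i. 1 \<le> i \<and> y i \<in> slab (real m)}"
  obtains i j where "1 \<le> i" "1 \<le> j" "\<And>k l. 1 \<le> k \<Longrightarrow> 1 \<le> l \<Longrightarrow> gap (x i) (y j) \<le> gap (x k) (y l)"
proof -
  define v where "v = gap (x 1) (y 1)"
  define F where "F = {(i, j). 1 \<le> i \<and> 1 \<le> j \<and> gap (x i) (y j) \<le> v}"
  obtain m :: nat where m: "v / eccentricity \<le> real m" using real_arch_simple by blast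
  have "F \<subseteq> {i. 1 \<le> i \<and> x i \<in> slab (real m)} \<times> {i. 1 \<le> i \<and> y i \<in> slab (real m)}"
  proof
    fix q assume "q \<in> F"
    then obtain i j where q: "q = (i, j)" and ij: "1 \<le> i" "1 \<le> j" "gap (x i) (y j) \<le> v"
      unfolding F_def by blast
    have "eccentricity * (x i $ e + y j $ e) \<le> v"
      using gap_ge[OF x[OF ij(1)] y[OF ij(2)]] ij(3) by (rule order_trans)
    then have "x i $ e + y j $ e \<le> v / eccentricity"
      using eccentricity_pos by (simp add: pos_le_divide_eq mult.commute)
    then have "x i $ e + y j $ e \<le> real m" using m by (rule order_trans)
    then have "x i \<in> slab (real m)" "y j \<in> slab (real m)"
      using parab_axis_nonneg[OF x[OF ij(1)]] parab_axis_nonneg[OF y[OF ij(2)]]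
        x[OF ij(1)] y[OF ij(2)] by (auto simp: slab_def)
    then show "q \<in> {i. 1 \<le> i \<and> x i \<in> slab (real m)} \<times> {i. 1 \<le> i \<and> y i \<in> slab (real m)}"
      using q ij by simp
  qed
  then have "finite F" using x_fin y_fin by (meson finite_SigmaI finite_subset)
  moreover have "(1, 1) \<in> F" by (simp add: F_def v_def)
  ultimately obtain q where q: "q \<in> F" "\<And>q'. q' \<in> F \<Longrightarrow> gap (x (fst q)) (y (snd q)) \<le> gap (x (fst q')) (y (snd q'))"
    using arg_min_if_finite(1)[of F "\<lambda>q. gap (x (fst q)) (y (snd q))"]
      arg_min_least[of F _ "\<lambda>q. gap (x (fst q)) (y (snd q))"] by blast
  show ?thesis
  proof (rule that[of "fst q" "snd q"])
    show "1 \<le> fst q" "1 \<le> snd q" using q(1) by (auto simp: F_def)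
    fix k l :: nat assume kl: "1 \<le> k" "1 \<le> l"
    show "gap (x (fst q)) (y (snd q)) \<le> gap (x k) (y l)"
    proof (cases "gap (x k) (y l) \<le> v")
      case True
      then have "(k, l) \<in> F" using kl by (simp add: F_def)
      from q(2)[OF this] show ?thesis by simp
    next
      case False
      have "gap (x (fst q)) (y (snd q)) \<le> v" using q(1) by (auto simp: F_def)
      then show ?thesis using False by linarith
    qed
  qed
qed

lemma INF_gap_eq:
  assumes "1 \<le> i" "1 \<le> j" "\<And>k l. 1 \<le> k \<Longrightarrow> 1 \<le> l \<Longrightarrow> gap (x i) (y j) \<le> gap (x k) (y l)"
  shows "(INF (k, l)\<in>{1::nat..} \<times> {1::nat..}. gap (x k) (y l)) = gap (x i) (y j)"
proof (rule cInf_eq_minimum)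
  show "gap (x i) (y j) \<in> (\<lambda>(k, l). gap (x k) (y l)) ` ({1..} \<times> {1..})"
    using assms(1,2) by (intro image_eqI[of _ _ "(i, j)"]) auto
qed (use assms(3) in auto)

end


section \<open>Poisson processes on the paraboloid and the limit theorem\<close>

context dominant_axis
begin

definition parab_intensity :: "(real ^ 'n) measure" where
  "parab_intensity = density lborel (\<lambda>z. ennreal density_const * indicator parab z)"

lemma density_const_pos: "0 < density_const"
  using solid_measure(1) by (simp add: density_const_def)

lemma sets_parab_intensity [simp]: "sets parab_intensity = sets borel"
  by (simp add: parab_intensity_def)

lemma emeasure_parab_intensity:
  "B \<in> sets borel \<Longrightarrow> emeasure parab_intensity B = ennreal density_const * emeasure lborel (parab \<inter> B)"
  unfolding parab_intensity_def by (rule emeasure_density_indicator) simp_all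

lemma emeasure_parab_intensity_bounded:
  assumes "B \<in> sets borel" "bounded B"
  shows "emeasure parab_intensity B < \<infinity>"
proof -
  have "emeasure lborel (parab \<inter> B) < \<infinity>"
    using assms(2) by (intro emeasure_bounded_finite) (auto intro: bounded_subset)
  then show ?thesis by (simp add: emeasure_parab_intensity[OF assms(1)] ennreal_mult_less_top)
qed

lemma measure_parab_intensity:
  "B \<in> sets borel \<Longrightarrow> measure parab_intensity B = density_const * measure lborel (parab \<inter> B)"
  using density_const_pos by (simp add: measure_def emeasure_parab_intensity enn2real_mult)

lemma parab_process_in_parab:
  assumes "prob_space M" and X: "poisson_process M parab_intensity X"
  shows "AE \<omega> in M. \<forall>i\<ge>1. X i \<omega> \<in> parab"
proof -
  interpret prob_space M by fact
  have "emeasure parab_intensity (- parab) = 0" by (simp add: emeasure_parab_intensity)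
  then have "AE \<omega> in M. \<forall>i\<ge>1. X i \<omega> \<notin> - parab"
    by (intro poisson_process_avoid_null[OF X]) simp_all
  then show ?thesis by simp
qed

lemma parab_process_slab_finite:
  assumes "prob_space M" and X: "poisson_process M parab_intensity X"
  shows "AE \<omega> in M. \<forall>m::nat. finite {i. 1 \<le> i \<and> X i \<omega> \<in> slab (real m)}"
proof -
  interpret prob_space M by fact
  have "AE \<omega> in M. finite {i. 1 \<le> i \<and> X i \<omega> \<in> slab (real m)}" for m
    by (intro poisson_process_locally_finite[OF X] emeasure_parab_intensity_bounded
        compact_imp_bounded slab_compact) simp_all
  then show ?thesis by (subst AE_all_countable) (rule allI)
qed

lemma parab_process_gap_minimum:
  assumes M: "prob_space M" and X: "poisson_process M parab_intensity X"
    and Y: "poisson_process M parab_intensity Y"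
  shows "AE \<omega> in M. \<exists>i\<ge>1. \<exists>j\<ge>1. \<forall>k\<ge>1. \<forall>l\<ge>1. gap (X i \<omega>) (Y j \<omega>) \<le> gap (X k \<omega>) (Y l \<omega>)"
  using parab_process_in_parab[OF M X] parab_process_in_parab[OF M Y]
    parab_process_slab_finite[OF M X] parab_process_slab_finite[OF M Y]
proof eventually_elim
  case (elim \<omega>)
  obtain i j where "1 \<le> i" "1 \<le> j" "\<And>k l. 1 \<le> k \<Longrightarrow> 1 \<le> l \<Longrightarrow> gap (X i \<omega>) (Y j \<omega>) \<le> gap (X k \<omega>) (Y l \<omega>)"
    by (rule gap_minimum_exists[of "\<lambda>i. X i \<omega>" "\<lambda>j. Y j \<omega>"]) (use elim in auto)
  then show ?case by blast
qed

text \<open>The requirements of \<open>diameter_weak_limit\<close> on the limit side are derived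
  from the Poisson assumptions, while the sample size stays abstract in \<open>avoid\<close>; both
  versions of the theorem are instances.\<close>

lemma diameter_limit:
  fixes Z :: "nat \<Rightarrow> 'w \<Rightarrow> real ^ 'n" and \<nu> :: "nat \<Rightarrow> 'w \<Rightarrow> nat"
    and X Y :: "nat \<Rightarrow> 'v \<Rightarrow> real ^ 'n"
  assumes M: "prob_space M" and M': "prob_space M'"
    and Z_meas: "\<And>i. 1 \<le> i \<Longrightarrow> Z i \<in> borel_measurable M"
    and Z_unif: "\<And>i. 1 \<le> i \<Longrightarrow> distr M borel (Z i) = uniform_measure lborel solid"
    and \<nu>_meas: "\<And>n. \<nu> n \<in> measurable M (count_space UNIV)"
    and avoid: "\<And>B l. (\<And>n. B n \<in> sets borel) \<Longrightarrow>
        (\<lambda>n. real n * measure (uniform_measure lborel solid) (B n)) \<longlonglongrightarrow> l \<Longrightarrow>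
        (\<lambda>n. measure M {\<omega> \<in> space M. \<forall>i\<in>{1..\<nu> n \<omega>}. Z i \<omega> \<notin> B n}) \<longlonglongrightarrow> exp (- l)"
    and X: "poisson_process M' parab_intensity X" and Y: "poisson_process M' parab_intensity Y"
    and indep: "indep_point_processes M' borel X Y"
  shows "weak_conv_m
    (\<lambda>n. distr M borel (\<lambda>\<omega>. rate n * (2 * b e - max_dist (\<lambda>i. Z i \<omega>) (\<nu> n \<omega>))))
    (distr M' borel (\<lambda>\<omega>. INF (i, j)\<in>{1..} \<times> {1..}. gap (X i \<omega>) (Y j \<omega>)))"
proof -
  interpret M': prob_space M' by fact
  have process_meas: "A i \<in> borel_measurable M'" if "1 \<le> i" "poisson_process M' parab_intensity A"
    for A :: "nat \<Rightarrow> 'v \<Rightarrow> real ^ 'n" and i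
  proof -
    have "A i \<in> measurable M' parab_intensity"
      using that unfolding poisson_process_def by blast
    then show ?thesis by (simp add: measurable_cong_sets[OF refl sets_parab_intensity])
  qed
  have gap_meas: "(\<lambda>p. gap (fst p) (snd p)) \<in> borel_measurable (borel \<Otimes>\<^sub>M borel)"
    unfolding borel_prod
    by (rule borel_measurable_continuous_onI) (auto simp: gap_def intro!: continuous_intros)
  have W_meas: "(\<lambda>\<omega>. INF (i, j)\<in>{1..} \<times> {1..}. gap (X i \<omega>) (Y j \<omega>)) \<in> borel_measurable M'"
    unfolding case_prod_beta'
  proof (rule borel_measurable_cINF_real)
    fix q :: "nat \<times> nat" assume "q \<in> {1..} \<times> {1..}"
    then have "X (fst q) \<in> borel_measurable M'" "Y (snd q) \<in> borel_measurable M'"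
      using process_meas X Y by auto
    from measurable_compose[OF measurable_Pair[OF this] gap_meas]
    show "(\<lambda>\<omega>. gap (X (fst q) \<omega>) (Y (snd q) \<omega>)) \<in> borel_measurable M'" by simp
  qed simp
  \<comment> \<open>\<open>INF\<close> on the reals is informative only for sets bounded below.
    Almost surely it is an attained minimum, which supplies the two properties demanded of
    \<open>W\<close>.\<close>
  have min: "AE \<omega> in M'. \<exists>i\<ge>1. \<exists>j\<ge>1. (INF (i, j)\<in>{1..} \<times> {1..}. gap (X i \<omega>) (Y j \<omega>)) = gap (X i \<omega>) (Y j \<omega>)
      \<and> (\<forall>k\<ge>1. \<forall>l\<ge>1. gap (X i \<omega>) (Y j \<omega>) \<le> gap (X k \<omega>) (Y l \<omega>))"
    using parab_process_gap_minimum[OF M' X Y]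
  proof eventually_elim
    case (elim \<omega>)
    then obtain i j where ij: "1 \<le> i" "1 \<le> j"
      "\<forall>k\<ge>1. \<forall>l\<ge>1. gap (X i \<omega>) (Y j \<omega>) \<le> gap (X k \<omega>) (Y l \<omega>)" by blast
    have "(INF (i, j)\<in>{1..} \<times> {1..}. gap (X i \<omega>) (Y j \<omega>)) = gap (X i \<omega>) (Y j \<omega>)"
      by (rule INF_gap_eq) (use ij in auto)
    then show ?case using ij by blast
  qed
  show ?thesis
  proof (rule diameter_weak_limit[where X = X and Y = Y, OF M M' Z_meas _ \<nu>_meas avoid _ _ _ _ _ W_meas])
    fix i :: nat assume i: "1 \<le> i"
    show "AE \<omega> in M. Z i \<omega> \<in> solid"
    proof -
      have "AE z in distr M borel (Z i). z \<in> solid"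
        unfolding Z_unif[OF i] using solid_measure by (intro AE_uniform_measureI) auto
      then show ?thesis by (subst (asm) AE_distr_iff) (use Z_meas[OF i] in auto)
    qed
    show "X i \<in> borel_measurable M'" "Y i \<in> borel_measurable M'" using process_meas[OF i] X Y by auto
  next
    show "AE \<omega> in M'. \<forall>i\<ge>1. X i \<omega> \<in> parab" "AE \<omega> in M'. \<forall>i\<ge>1. Y i \<omega> \<in> parab"
      by (rule parab_process_in_parab[OF M' X], rule parab_process_in_parab[OF M' Y])
  next
    fix U V :: "(real ^ 'n) set"
    assume UV: "U \<in> sets borel" "V \<in> sets borel" "bounded U" "bounded V"
    have "measure M' {\<omega> \<in> space M'. (\<forall>i\<ge>1. X i \<omega> \<notin> U) \<and> (\<forall>i\<ge>1. Y i \<omega> \<notin> V)}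
        = exp (- (measure parab_intensity U + measure parab_intensity V))"
      using UV by (intro M'.indep_poisson_processes_avoid[OF X Y indep] emeasure_parab_intensity_bounded) auto
    then show "measure M' {\<omega> \<in> space M'. (\<forall>i\<ge>1. X i \<omega> \<notin> U) \<and> (\<forall>i\<ge>1. Y i \<omega> \<notin> V)}
        = exp (- (density_const * (measure lborel (parab \<inter> U) + measure lborel (parab \<inter> V))))"
      using UV by (simp add: measure_parab_intensity distrib_left)
  next
    show "AE \<omega> in M'. \<forall>i\<ge>1. \<forall>j\<ge>1. (INF (i, j)\<in>{1..} \<times> {1..}. gap (X i \<omega>) (Y j \<omega>)) \<le> gap (X i \<omega>) (Y j \<omega>)"
      using min by (rule eventually_mono) auto
    show "AE \<omega> in M'. \<exists>i\<ge>1. \<exists>j\<ge>1. (INF (i, j)\<in>{1..} \<times> {1..}. gap (X i \<omega>) (Y j \<omega>)) = gap (X i \<omega>) (Y j \<omega>)"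
      using min by (rule eventually_mono) blast
  qed
qed

end

section \<open>The theorem in the given coordinates\<close>

text \<open>The law of \<open>N n\<close> is prescribed for n >= 1 only, so the sample size at n = 0
  has to be replaced without affecting the limit.\<close>

lemma weak_conv_m_eventually_cong:
  assumes "weak_conv_m \<mu> \<mu>'" and "\<forall>\<^sub>F n in sequentially. \<mu> n = \<mu>2 n"
  shows "weak_conv_m \<mu>2 \<mu>'"
  unfolding weak_conv_m_def weak_conv_def
proof (intro allI impI)
  fix x assume "isCont (cdf \<mu>') x"
  then have "(\<lambda>n. cdf (\<mu> n) x) \<longlonglongrightarrow> cdf \<mu>' x"
    using assms(1) by (simp add: weak_conv_m_def weak_conv_def)
  moreover have "\<forall>\<^sub>F n in sequentially. cdf (\<mu> n) x = cdf (\<mu>2 n) x"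
    using assms(2) by (rule eventually_mono) simp
  ultimately show "(\<lambda>n. cdf (\<mu>2 n) x) \<longlonglongrightarrow> cdf \<mu>' x" by (rule Lim_transform_eventually)
qed

text \<open>The second conjunct says that the minimum over pairs is almost surely attained, so that
  \<open>INF\<close> in the limit law is a genuine minimum. The planar case is the general one
  evaluated at d = 2, where Gamma (2) = 1 and the tail has a single coordinate.\<close>

theorem corollary2:
  fixes ix :: "nat \<Rightarrow> 'n::finite"
    and a :: "nat \<Rightarrow> real"
    and E P :: "(real ^ 'n) set"
    and p :: real
    and M :: "'w measure"
    and Z :: "nat \<Rightarrow> 'w \<Rightarrow> real ^ 'n"
    and N :: "nat \<Rightarrow> 'w \<Rightarrow> nat"
    and M' :: "'v measure"
    and X Y :: "nat \<Rightarrow> 'v \<Rightarrow> real ^ 'n"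
  assumes dim: "CARD('n) \<ge> 2"
    and ix: "bij_betw ix {1..CARD('n)} UNIV"
    and a_first: "a 1 > a 2"
    and a_decr: "\<forall>j\<in>{2..<CARD('n)}. a j \<ge> a (Suc j)"
    and a_pos: "a CARD('n) > 0"
    and E_def: "E = ellipsoid ix a"
    and P_def: "P = paraboloid ix a"
    and p_def: "p = 1 / measure lborel E"
    and M: "prob_space M"
    and Z_indep: "prob_space.indep_vars M (\<lambda>_. borel) Z {1..}"
    and Z_unif: "\<forall>i\<ge>1. distr M borel (Z i) = uniform_measure lborel E"
    and N_poisson: "\<forall>n\<ge>1. distr M (count_space UNIV) (N n) = measure_pmf (poisson_pmf (real n))"
    and N_indep: "\<forall>n\<ge>1. indep_rv M (count_space UNIV) (N n)
                    (PiM {1..} (\<lambda>_. borel)) (\<lambda>\<omega>. \<lambda>i\<in>{1..}. Z i \<omega>)"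
    and M': "prob_space M'"
    and X: "poisson_process M' (density lborel (\<lambda>z. ennreal p * indicator P z)) X"
    and Y: "poisson_process M' (density lborel (\<lambda>z. ennreal p * indicator P z)) Y"
    and XY_indep: "indep_point_processes M' borel X Y"
  shows "p = inverse (pi powr (real CARD('n) / 2) / Gamma (real CARD('n) / 2 + 1)
               * (\<Prod>i=1..CARD('n). a i)) \<and>
         (AE \<omega> in M'. \<exists>i\<ge>1. \<exists>j\<ge>1. \<forall>k\<ge>1. \<forall>l\<ge>1.
           pair_value ix a (X i \<omega>) (Y j \<omega>) \<le> pair_value ix a (X k \<omega>) (Y l \<omega>)) \<and>
         weak_conv_m
           (\<lambda>n. distr M borel (\<lambda>\<omega>. real n powr (2 / (real CARD('n) + 1)) *
                  (2 * a 1 - max_dist (\<lambda>i. Z i \<omega>) (N n \<omega>))))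
           (distr M' borel (\<lambda>\<omega>. INF (i, j)\<in>{1..} \<times> {1..}. pair_value ix a (X i \<omega>) (Y j \<omega>))) \<and>
         weak_conv_m
           (\<lambda>n. distr M borel (\<lambda>\<omega>. real n powr (2 / (real CARD('n) + 1)) *
                  (2 * a 1 - max_dist (\<lambda>i. Z i \<omega>) n)))
           (distr M' borel (\<lambda>\<omega>. INF (i, j)\<in>{1..} \<times> {1..}. pair_value ix a (X i \<omega>) (Y j \<omega>))) \<and>
         (CARD('n) = 2 \<and> a 1 = 1 \<longrightarrow>
           p = 1 / (pi * a 2) \<and>
           P = {z. (z $ ix 2 / a 2)\<^sup>2 \<le> 2 * z $ ix 1} \<and>
           weak_conv_m
             (\<lambda>n. distr M borel (\<lambda>\<omega>. real n powr (2 / 3) * (2 - max_dist (\<lambda>i. Z i \<omega>) n)))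
             (distr M' borel (\<lambda>\<omega>. INF (i, j)\<in>{1..} \<times> {1..}.
                X i \<omega> $ ix 1 + Y j \<omega> $ ix 1 - 1 / 4 * (X i \<omega> $ ix 2 - Y j \<omega> $ ix 2)\<^sup>2)))"
proof -
  interpret M: prob_space M by (rule M)
  define e where "e = ix 1"
  \<comment> \<open>Semi-axes indexed by coordinates instead of by rank; \<open>inv_into\<close>
    undoes the enumeration \<open>ix\<close>.\<close>
  define b where "b i = a (inv_into {1..CARD('n)} ix i)" for i
  have inj: "inj_on ix {1..CARD('n)}" and surj: "ix ` {1..CARD('n)} = UNIV"
    using ix by (auto simp: bij_betw_def)
  have b_ix: "b (ix j) = a j" if "j \<in> {1..CARD('n)}" for j
    using inj that by (simp add: b_def)
  have ix_cases: "\<exists>j\<in>{1..CARD('n)}. i = ix j" for i using surj by auto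
  have a_le: "a k \<le> a j" if "2 \<le> j" "j \<le> k" "k \<le> CARD('n)" for j k
    using that(2,3)
  proof (induction k rule: dec_induct)
    case (step k)
    then have "a (Suc k) \<le> a k" using a_decr that(1) by simp
    then show ?case using step by simp
  qed simp
  have a_pos': "0 < a j" if "1 \<le> j" "j \<le> CARD('n)" for j
  proof -
    have "0 < a k" if "2 \<le> k" "k \<le> CARD('n)" for k
      using a_le[of k "CARD('n)"] a_pos that by simp
    then show ?thesis using that a_first dim by (cases "j = 1") force+
  qed
  have one_in: "1 \<in> {1..CARD('n)}" using dim by simp
  \<comment> \<open>The semi-axes decrease from the second on, so \<open>a 2\<close> bounds all but
    the long one, and a_1 > a_2 gives the strict separation.\<close>
  interpret dominant_axis e b "a 2"
  proof
    show "0 < b i" for i using ix_cases[of i] b_ix a_pos' by auto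
    show "b i \<le> a 2" if "i \<noteq> e" for i
    proof -
      obtain j where j: "j \<in> {1..CARD('n)}" "i = ix j" using ix_cases by blast
      then have "j \<noteq> 1" using that by (auto simp: e_def)
      then show ?thesis using j a_le[of 2 j] by (simp add: b_ix)
    qed
    show "0 < a 2" using a_pos' dim by simp
    show "a 2 < b e" using a_first b_ix[OF one_in] by (simp add: e_def)
  qed
  have be: "b e = a 1" using b_ix[OF one_in] by (simp add: e_def)
  have tail_bij: "bij_betw ix {2..CARD('n)} (-{e})"
  proof -
    have "{1..CARD('n)} - {1} = {2..CARD('n)}" by auto
    then show ?thesis
      using bij_betw_DiffI[OF ix bij_betw_singletonI[of ix 1 e]] one_in
      by (simp add: e_def Compl_eq_Diff_UNIV)
  qed
  have tail_sum: "(\<Sum>j=2..CARD('n). f (ix j)) = (\<Sum>i\<in>-{e}. f i)" for f :: "'n \<Rightarrow> real"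
    by (rule sum.reindex_bij_betw[OF tail_bij])
  have tail: "(\<Sum>j=2..CARD('n). (z $ ix j / a j)\<^sup>2) = tail_form z" for z
  proof -
    have "(\<Sum>j=2..CARD('n). (z $ ix j / a j)\<^sup>2) = (\<Sum>j=2..CARD('n). (z $ ix j / b (ix j))\<^sup>2)"
      by (rule sum.cong) (simp_all add: b_ix)
    then show ?thesis using tail_sum[of "\<lambda>i. (z $ i / b i)\<^sup>2"] by (simp add: tail_form_def)
  qed
  have E: "E = solid"
  proof -
    have "(\<Sum>j=1..CARD('n). (z $ ix j / a j)\<^sup>2) = (z $ e / b e)\<^sup>2 + tail_form z" for z
    proof -
      have "(\<Sum>j=1..CARD('n). (z $ ix j / a j)\<^sup>2)
          = (z $ ix 1 / a 1)\<^sup>2 + (\<Sum>j=Suc 1..CARD('n). (z $ ix j / a j)\<^sup>2)"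
        using dim by (intro sum.atLeast_Suc_atMost) simp
      then show ?thesis by (simp only: Suc_1 tail be) (simp only: e_def)
    qed
    then show ?thesis by (simp add: E_def ellipsoid_def solid_def)
  qed
  have P: "P = parab"
    by (simp only: P_def paraboloid_def parab_def tail be) (simp only: e_def)
  have gap: "pair_value ix a x y = gap x y" for x y
  proof -
    have "(tail_diff_norm ix x y)\<^sup>2 = (\<Sum>i\<in>-{e}. (x $ i - y $ i)\<^sup>2)"
      using tail_sum[of "\<lambda>i. (x $ i - y $ i)\<^sup>2"]
      by (simp add: tail_diff_norm_def L2_set_def sum_nonneg)
    then show ?thesis
      unfolding pair_value_def gap_def be e_def[symmetric] by simp
  qed
  have p: "p = density_const" by (simp add: p_def density_const_def E)
  have intensity: "density lborel (\<lambda>z. ennreal p * indicator P z) = parab_intensity"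
    by (simp add: parab_intensity_def p P)
  have X': "poisson_process M' parab_intensity X" and Y': "poisson_process M' parab_intensity Y"
    using X Y by (simp_all add: intensity)
  have prod_b: "(\<Prod>i\<in>UNIV. b i) = (\<Prod>i=1..CARD('n). a i)"
    unfolding prod.reindex_bij_betw[OF ix, symmetric] by (rule prod.cong) (simp_all add: b_ix)
  have p_formula: "p = inverse (pi powr (real CARD('n) / 2) / Gamma (real CARD('n) / 2 + 1)
               * (\<Prod>i=1..CARD('n). a i))"
  proof -
    have "0 \<le> unit_ball_vol (real CARD('n)) * (\<Prod>i\<in>UNIV. b i)"
      using axes_pos by (intro mult_nonneg_nonneg prod_nonneg) (auto simp: less_imp_le)
    then have "measure lborel E = unit_ball_vol (real CARD('n)) * (\<Prod>i=1..CARD('n). a i)"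
      by (simp add: E measure_def emeasure_solid prod_b)
    then show ?thesis by (simp add: p_def unit_ball_vol_def inverse_eq_divide)
  qed

  have Z_meas: "Z i \<in> borel_measurable M" if "1 \<le> i" for i
    using Z_indep that by (auto simp: M.indep_vars_def)
  have Z_unif': "distr M borel (Z i) = uniform_measure lborel solid" if "1 \<le> i" for i
    using Z_unif that E by simp
  interpret D: prob_space "uniform_measure lborel solid"
    using solid_measure by (intro prob_space_uniform_measure) auto

  have fixed_size: "weak_conv_m
    (\<lambda>n. distr M borel (\<lambda>\<omega>. rate n * (2 * b e - max_dist (\<lambda>i. Z i \<omega>) n)))
    (distr M' borel (\<lambda>\<omega>. INF (i, j)\<in>{1..} \<times> {1..}. gap (X i \<omega>) (Y j \<omega>)))"
  proof (rule diameter_limit[where \<nu> = "\<lambda>n \<omega>. n", OF M M' Z_meas Z_unif' _ _ X' Y' XY_indep])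
    fix B l
    assume B: "\<And>n. B n \<in> sets borel"
      and lim: "(\<lambda>n. real n * measure (uniform_measure lborel solid) (B n)) \<longlonglongrightarrow> l"
    have "measure M {\<omega> \<in> space M. \<forall>i\<in>{1..n}. Z i \<omega> \<notin> B n}
        = (1 - measure (uniform_measure lborel solid) (B n)) ^ n" for n
      by (rule M.prob_avoid_indep[OF Z_indep Z_unif' B])
    moreover have "(\<lambda>n. (1 - measure (uniform_measure lborel solid) (B n)) ^ n) \<longlonglongrightarrow> exp (- l)"
      by (rule power_one_minus_tendsto_exp[OF _ _ lim]) simp_all
    ultimately show "(\<lambda>n. measure M {\<omega> \<in> space M. \<forall>i\<in>{1..n}. Z i \<omega> \<notin> B n}) \<longlonglongrightarrow> exp (- l)"
      by (simp only:)
  qed simp_all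

  \<comment> \<open>\<open>N 0\<close> is arbitrary and possibly not measurable; \<open>N'\<close>
    sets it to 0, since \<open>diameter_limit\<close> asks for measurable sample sizes at every
    n.\<close>
  define N' where "N' n = (if n = 0 then (\<lambda>_. 0) else N n)" for n
  have poissonized: "weak_conv_m
    (\<lambda>n. distr M borel (\<lambda>\<omega>. rate n * (2 * b e - max_dist (\<lambda>i. Z i \<omega>) (N' n \<omega>))))
    (distr M' borel (\<lambda>\<omega>. INF (i, j)\<in>{1..} \<times> {1..}. gap (X i \<omega>) (Y j \<omega>)))"
  proof (rule diameter_limit[OF M M' Z_meas Z_unif' _ _ X' Y' XY_indep])
    fix n show "N' n \<in> measurable M (count_space UNIV)"
      using N_indep by (cases "n = 0") (auto simp: N'_def indep_rv_def)
  next
    fix B l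
    assume B: "\<And>n. B n \<in> sets borel"
      and lim: "(\<lambda>n. real n * measure (uniform_measure lborel solid) (B n)) \<longlonglongrightarrow> l"
    have void: "measure M {\<omega> \<in> space M. \<forall>i\<in>{1..N' n \<omega>}. Z i \<omega> \<notin> B n}
        = exp (- (real n * measure (uniform_measure lborel solid) (B n)))" if "1 \<le> n" for n
    proof -
      have "N' n = N n" using that by (simp add: N'_def)
      moreover have "measure M {\<omega> \<in> space M. \<forall>i\<in>{1..N n \<omega>}. Z i \<omega> \<notin> B n}
        = exp (- (real n * measure (uniform_measure lborel solid) (B n)))"
        by (rule M.prob_avoid_poissonized[OF Z_indep Z_unif' _ N_poisson[rule_format, OF that]
              N_indep[rule_format, OF that] B]) (use that in simp_all)
      ultimately show ?thesis by (simp only:)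
    qed
    have "\<forall>\<^sub>F n in sequentially. exp (- (real n * measure (uniform_measure lborel solid) (B n)))
        = measure M {\<omega> \<in> space M. \<forall>i\<in>{1..N' n \<omega>}. Z i \<omega> \<notin> B n}"
      using eventually_ge_at_top[of 1] by (rule eventually_mono) (rule void[symmetric])
    moreover have "(\<lambda>n. exp (- (real n * measure (uniform_measure lborel solid) (B n)))) \<longlonglongrightarrow> exp (- l)"
      by (intro tendsto_exp tendsto_minus lim)
    ultimately show "(\<lambda>n. measure M {\<omega> \<in> space M. \<forall>i\<in>{1..N' n \<omega>}. Z i \<omega> \<notin> B n}) \<longlonglongrightarrow> exp (- l)"
      by (rule Lim_transform_eventually[rotated])
  qed
  have random_size: "weak_conv_m
    (\<lambda>n. distr M borel (\<lambda>\<omega>. rate n * (2 * b e - max_dist (\<lambda>i. Z i \<omega>) (N n \<omega>))))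
    (distr M' borel (\<lambda>\<omega>. INF (i, j)\<in>{1..} \<times> {1..}. gap (X i \<omega>) (Y j \<omega>)))"
  proof (rule weak_conv_m_eventually_cong[OF poissonized])
    show "\<forall>\<^sub>F n in sequentially.
        distr M borel (\<lambda>\<omega>. rate n * (2 * b e - max_dist (\<lambda>i. Z i \<omega>) (N' n \<omega>)))
      = distr M borel (\<lambda>\<omega>. rate n * (2 * b e - max_dist (\<lambda>i. Z i \<omega>) (N n \<omega>)))"
      using eventually_ge_at_top[of 1] by (rule eventually_mono) (simp add: N'_def)
  qed

  show ?thesis
  proof (intro conjI impI)
    show "p = inverse (pi powr (real CARD('n) / 2) / Gamma (real CARD('n) / 2 + 1)
               * (\<Prod>i=1..CARD('n). a i))" by (rule p_formula)
    show "AE \<omega> in M'. \<exists>i\<ge>1. \<exists>j\<ge>1. \<forall>k\<ge>1. \<forall>l\<ge>1.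
           pair_value ix a (X i \<omega>) (Y j \<omega>) \<le> pair_value ix a (X k \<omega>) (Y l \<omega>)"
      unfolding gap by (rule parab_process_gap_minimum[OF M' X' Y'])
    show "weak_conv_m
           (\<lambda>n. distr M borel (\<lambda>\<omega>. real n powr (2 / (real CARD('n) + 1)) *
                  (2 * a 1 - max_dist (\<lambda>i. Z i \<omega>) (N n \<omega>))))
           (distr M' borel (\<lambda>\<omega>. INF (i, j)\<in>{1..} \<times> {1..}. pair_value ix a (X i \<omega>) (Y j \<omega>)))"
      using random_size unfolding gap rate_def be .
    show fixed: "weak_conv_m
           (\<lambda>n. distr M borel (\<lambda>\<omega>. real n powr (2 / (real CARD('n) + 1)) *
                  (2 * a 1 - max_dist (\<lambda>i. Z i \<omega>) n)))
           (distr M' borel (\<lambda>\<omega>. INF (i, j)\<in>{1..} \<times> {1..}. pair_value ix a (X i \<omega>) (Y j \<omega>)))"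
      using fixed_size unfolding gap rate_def be .
    assume d2: "CARD('n) = 2 \<and> a 1 = 1"
    show "p = 1 / (pi * a 2)"
    proof -
      have "Gamma (2 :: real) = 1" using Gamma_fact[of 1, where 'a = real] by simp
      moreover have "(\<Prod>i=1..2. a i) = a 1 * a 2" by (simp add: numeral_2_eq_2)
      ultimately show ?thesis using d2 p_formula by (simp add: inverse_eq_divide)
    qed
    show "P = {z. (z $ ix 2 / a 2)\<^sup>2 \<le> 2 * z $ ix 1}"
      using d2 by (simp add: P_def paraboloid_def)
    have "pair_value ix a x y = x $ ix 1 + y $ ix 1 - 1 / 4 * (x $ ix 2 - y $ ix 2)\<^sup>2" for x y
      using d2 by (simp add: pair_value_def tail_diff_norm_def L2_set_def)
    with fixed d2 show "weak_conv_m
             (\<lambda>n. distr M borel (\<lambda>\<omega>. real n powr (2 / 3) * (2 - max_dist (\<lambda>i. Z i \<omega>) n)))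
             (distr M' borel (\<lambda>\<omega>. INF (i, j)\<in>{1..} \<times> {1..}.
                X i \<omega> $ ix 1 + Y j \<omega> $ ix 1 - 1 / 4 * (X i \<omega> $ ix 2 - Y j \<omega> $ ix 2)\<^sup>2))"
      by simp
  qed
qed

end
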